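(* The group $E_{6(-26),\mathbb H}=\{\alpha\in \mathrm{Iso}_{\mathbb R}(\mathfrak J(3,\mathbb H)) \mid \det(\alpha X)=\det X \text{ for all } X\}$ is isomorphic to the group $SU^*(6)/\mathbb Z_2$, where $\mathbb Z_2=\{E,-E\}$.
   Context: $\mathbb H$ is the quaternion algebra with conjugation $x\mapsto\overline x$; $X^*={}^t\overline X$. $\mathfrak J(3,\mathbb H)=\{X\in M(3,\mathbb H)\mid X^*=X\}$, whose elements are $X=\begin{pmatrix}\xi_1&x_3&\overline x_2\\ \overline x_3&\xi_2&x_1\\ x_2&\overline x_1&\xi_3\end{pmatrix}$, $\xi_i\in\mathbb R$, $x_i\in\mathbb H$, and $\det X:=\xi_1\xi_2\xi_3+x_1x_2x_3+\overline{x_1x_2x_3}-\sum_i\xi_ix_i\overline x_i\in\mathbb R$. $\mathrm{Iso}_{\mathbb R}(V)$ is the group of $\mathbb R$-linear automorphisms of $V$. $SU^*(6)=\{A\in M(6,\mathbb C)\mid JA=\overline AJ,\ \det A=1\}$, with $J=\mathrm{diag}(J_1,J_1,J_1)$, $J_1=\begin{pmatrix}0&1\\-1&0\end{pmatrix}$. *)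

theory Defs
  imports "HOL-Analysis.Analysis" "HOL-Algebra.Coset" "HOL-Algebra.Bij"
begin

section \<open>The quaternions\<close>

datatype quat = Quat (qre: real) (qi: real) (qj: real) (qk: real)

lemma quat_eq_iff:
  "x = y \<longleftrightarrow> qre x = qre y \<and> qi x = qi y \<and> qj x = qj y \<and> qk x = qk y"
  by (cases x; cases y) auto

instantiation quat :: real_algebra_1
begin

definition zero_quat :: quat where "0 = Quat 0 0 0 0"

definition one_quat :: quat where "1 = Quat 1 0 0 0"

definition plus_quat :: "quat \<Rightarrow> quat \<Rightarrow> quat" where
  "x + y = Quat (qre x + qre y) (qi x + qi y) (qj x + qj y) (qk x + qk y)"

definition uminus_quat :: "quat \<Rightarrow> quat" where
  "- x = Quat (- qre x) (- qi x) (- qj x) (- qk x)"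

definition minus_quat :: "quat \<Rightarrow> quat \<Rightarrow> quat" where
  "x - y = Quat (qre x - qre y) (qi x - qi y) (qj x - qj y) (qk x - qk y)"

definition times_quat :: "quat \<Rightarrow> quat \<Rightarrow> quat" where
  "x * y = Quat
     (qre x * qre y - qi x * qi y - qj x * qj y - qk x * qk y)
     (qre x * qi y + qi x * qre y + qj x * qk y - qk x * qj y)
     (qre x * qj y - qi x * qk y + qj x * qre y + qk x * qi y)
     (qre x * qk y + qi x * qj y - qj x * qi y + qk x * qre y)"

definition scaleR_quat :: "real \<Rightarrow> quat \<Rightarrow> quat" where
  "r *\<^sub>R x = Quat (r * qre x) (r * qi x) (r * qj x) (r * qk x)"

instance
  by standard
    (simp_all add: quat_eq_iff zero_quat_def one_quat_def plus_quat_def uminus_quat_def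
      minus_quat_def times_quat_def scaleR_quat_def algebra_simps)

end

definition qcnj :: "quat \<Rightarrow> quat" where
  "qcnj x = Quat (qre x) (- qi x) (- qj x) (- qk x)"


section \<open>The Jordan algebra of Hermitian quaternionic matrices and its determinant\<close>

definition hadj :: "quat^'n^'m \<Rightarrow> quat^'m^'n" where
  "hadj X = transpose (map_matrix qcnj X)"

definition J3H :: "(quat^3^3) set" where
  "J3H = {X. hadj X = X}"

definition herm3 :: "real \<Rightarrow> real \<Rightarrow> real \<Rightarrow> quat \<Rightarrow> quat \<Rightarrow> quat \<Rightarrow> quat^3^3" where
  "herm3 \<xi>1 \<xi>2 \<xi>3 x1 x2 x3 =
     vector [vector [of_real \<xi>1, x3, qcnj x2],
             vector [qcnj x3, of_real \<xi>2, x1],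
             vector [x2, qcnj x1, of_real \<xi>3]]"

text \<open>
  The entries are read off in accordance with \<^const>\<open>herm3\<close>. The quaternionic expression is
  real on \<^const>\<open>J3H\<close> (lemma \<open>of_real_detJ_herm3\<close>), so taking the real part there only
  changes the type.
\<close>

definition detJ :: "quat^3^3 \<Rightarrow> real" where
  "detJ X =
    (let \<xi>1 = X $ 1 $ 1; \<xi>2 = X $ 2 $ 2; \<xi>3 = X $ 3 $ 3;
         x1 = X $ 2 $ 3; x2 = X $ 3 $ 1; x3 = X $ 1 $ 2
     in qre (\<xi>1 * \<xi>2 * \<xi>3 + x1 * x2 * x3 + qcnj (x1 * x2 * x3)
             - (\<xi>1 * x1 * qcnj x1 + \<xi>2 * x2 * qcnj x2 + \<xi>3 * x3 * qcnj x3)))"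

lemma of_real_quat: "of_real r = Quat r 0 0 0"
  by (simp add: of_real_def one_quat_def scaleR_quat_def)

lemma J3H_iff: "X \<in> J3H \<longleftrightarrow> (\<exists>\<xi>1 \<xi>2 \<xi>3 x1 x2 x3. X = herm3 \<xi>1 \<xi>2 \<xi>3 x1 x2 x3)"
proof
  assume "X \<in> J3H"
  then have e: "qcnj (X $ i $ j) = X $ j $ i" for i j
    by (simp add: J3H_def hadj_def vec_eq_iff transpose_def)
  have d: "X $ i $ i = of_real (qre (X $ i $ i))" for i
    using e[of i i] by (simp add: quat_eq_iff qcnj_def of_real_quat)
  have "X = herm3 (qre (X $ 1 $ 1)) (qre (X $ 2 $ 2)) (qre (X $ 3 $ 3))
      (X $ 2 $ 3) (X $ 3 $ 1) (X $ 1 $ 2)"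
    by (simp add: vec_eq_iff forall_3 herm3_def e flip: d)
  then show "\<exists>\<xi>1 \<xi>2 \<xi>3 x1 x2 x3. X = herm3 \<xi>1 \<xi>2 \<xi>3 x1 x2 x3"
    by blast
next
  assume "\<exists>\<xi>1 \<xi>2 \<xi>3 x1 x2 x3. X = herm3 \<xi>1 \<xi>2 \<xi>3 x1 x2 x3"
  then show "X \<in> J3H"
    by (auto simp: J3H_def hadj_def herm3_def vec_eq_iff forall_3 transpose_def
        qcnj_def of_real_quat)
qed

lemma of_real_detJ_herm3:
  "(of_real (detJ (herm3 \<xi>1 \<xi>2 \<xi>3 x1 x2 x3)) :: quat) =
     of_real (\<xi>1 * \<xi>2 * \<xi>3) + x1 * x2 * x3 + qcnj (x1 * x2 * x3)
     - (\<xi>1 *\<^sub>R (x1 * qcnj x1) + \<xi>2 *\<^sub>R (x2 * qcnj x2) + \<xi>3 *\<^sub>R (x3 * qcnj x3))"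
  by (simp add: detJ_def herm3_def of_real_quat quat_eq_iff qcnj_def plus_quat_def
      minus_quat_def times_quat_def scaleR_quat_def algebra_simps)


section \<open>The two groups\<close>

text \<open>
  Maps on \<^const>\<open>J3H\<close> are represented by functions extensional on \<^const>\<open>J3H\<close>, as in
  \<^const>\<open>Bij\<close>, so that distinct elements of the carrier are distinct maps.
\<close>

definition Iso_J3H :: "(quat^3^3 \<Rightarrow> quat^3^3) set" where
  "Iso_J3H = {\<alpha> \<in> Bij J3H.
     (\<forall>X\<in>J3H. \<forall>Y\<in>J3H. \<alpha> (X + Y) = \<alpha> X + \<alpha> Y) \<and>
     (\<forall>c::real. \<forall>X\<in>J3H. \<alpha> (c *\<^sub>R X) = c *\<^sub>R \<alpha> X)}"

definition E6H :: "(quat^3^3 \<Rightarrow> quat^3^3) monoid" where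
  "E6H = (BijGroup J3H) \<lparr>carrier := {\<alpha> \<in> Iso_J3H. \<forall>X\<in>J3H. detJ (\<alpha> X) = detJ X}\<rparr>"

text \<open>
  In the index type \<open>6\<close> the numerals \<open>1, \<dots>, 6\<close> denote its six elements, with \<open>6 = 0\<close>.
\<close>

definition Jmat :: "complex^6^6" where
  "Jmat = (\<chi> i j. if (i, j) \<in> {(1, 2), (3, 4), (5, 6)} then 1
                  else if (i, j) \<in> {(2, 1), (4, 3), (6, 5)} then - 1
                  else 0)"

definition SUstar6 :: "(complex^6^6) monoid" where
  "SUstar6 = \<lparr>carrier = {A. Jmat ** A = map_matrix cnj A ** Jmat \<and> det A = 1},
              mult = (**), one = mat 1\<rparr>"

lemma J3H_add: "X \<in> J3H \<Longrightarrow> Y \<in> J3H \<Longrightarrow> X + Y \<in> J3H"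
  and J3H_scaleR: "X \<in> J3H \<Longrightarrow> c *\<^sub>R X \<in> J3H"
  by (simp_all add: J3H_def hadj_def vec_eq_iff transpose_def quat_eq_iff qcnj_def
      plus_quat_def scaleR_quat_def flip: mult_minus_right)

lemma group_E6H: "group E6H"
proof -
  interpret B: group "BijGroup J3H" by (rule group_BijGroup)
  let ?S = "{\<alpha> \<in> Iso_J3H. \<forall>X\<in>J3H. detJ (\<alpha> X) = detJ X}"
  have inv: "inv\<^bsub>BijGroup J3H\<^esub> f = restrict (inv_into J3H f) J3H" if "f \<in> Bij J3H" for f
    using that by (rule inv_BijGroup)
  have mem: "f X \<in> J3H" if "f \<in> Bij J3H" "X \<in> J3H" for f X
    using that Bij_imp_funcset by blast
  have "subgroup ?S (BijGroup J3H)"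
  proof (rule B.subgroupI)
    show "?S \<subseteq> carrier (BijGroup J3H)"
      by (auto simp: Iso_J3H_def BijGroup_def)
    have "(\<lambda>x\<in>J3H. x) \<in> ?S"
      by (simp add: Iso_J3H_def id_Bij J3H_add J3H_scaleR)
    then show "?S \<noteq> {}" by blast
  next
    fix f assume f: "f \<in> ?S"
    then have fB: "f \<in> Bij J3H"
      and fa: "\<And>X Y. X \<in> J3H \<Longrightarrow> Y \<in> J3H \<Longrightarrow> f (X + Y) = f X + f Y"
      and fs: "\<And>c X. X \<in> J3H \<Longrightarrow> f (c *\<^sub>R X) = c *\<^sub>R f X"
      and fd: "\<And>X. X \<in> J3H \<Longrightarrow> detJ (f X) = detJ X"
      by (auto simp: Iso_J3H_def)
    let ?g = "inv_into J3H f"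
    have bij: "bij_betw f J3H J3H" using fB by (simp add: Bij_def)
    have g: "?g X \<in> J3H" "f (?g X) = X" if "X \<in> J3H" for X
      using bij that Bij_inv_into_mem[OF fB] by (auto simp: bij_betw_inv_into_right)
    have gf: "?g (f X) = X" if "X \<in> J3H" for X
      using bij that by (simp add: bij_betw_inv_into_left)
    have "?g (X + Y) = ?g X + ?g Y" if "X \<in> J3H" "Y \<in> J3H" for X Y
      using gf[of "?g X + ?g Y"] that by (simp add: fa g J3H_add)
    moreover have "?g (c *\<^sub>R X) = c *\<^sub>R ?g X" if "X \<in> J3H" for c X
      using gf[of "c *\<^sub>R ?g X"] that by (simp add: fs g J3H_scaleR)
    moreover have "detJ (?g X) = detJ X" if "X \<in> J3H" for X
      using fd[of "?g X"] that by (simp add: g)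
    ultimately show "inv\<^bsub>BijGroup J3H\<^esub> f \<in> ?S"
      by (simp add: inv[OF fB] Iso_J3H_def restrict_inv_into_Bij[OF fB] J3H_add J3H_scaleR)
  next
    fix f g assume "f \<in> ?S" "g \<in> ?S"
    then show "f \<otimes>\<^bsub>BijGroup J3H\<^esub> g \<in> ?S"
      by (simp add: Iso_J3H_def BijGroup_def compose_Bij compose_eq J3H_add J3H_scaleR mem)
  qed
  then show ?thesis
    unfolding E6H_def by (rule B.subgroup_imp_group)
qed

lemma map_matrix_cnj_mult:
  fixes A B :: "complex^6^6"
  shows "map_matrix cnj (A ** B) = map_matrix cnj A ** map_matrix cnj B"
  by (simp add: vec_eq_iff matrix_matrix_mult_def)

lemma map_matrix_cnj_one: "map_matrix cnj (mat 1 :: complex^6^6) = mat 1"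
  by (simp add: vec_eq_iff mat_def)

lemma group_SUstar6: "group SUstar6"
proof (rule groupI)
  fix A B assume A: "A \<in> carrier SUstar6" and B: "B \<in> carrier SUstar6"
  have "Jmat ** (A ** B) = (map_matrix cnj A ** Jmat) ** B"
    using A by (simp add: SUstar6_def matrix_mul_assoc)
  also have "\<dots> = map_matrix cnj A ** (map_matrix cnj B ** Jmat)"
    using B by (simp add: SUstar6_def flip: matrix_mul_assoc)
  finally show "A \<otimes>\<^bsub>SUstar6\<^esub> B \<in> carrier SUstar6"
    using A B by (simp add: SUstar6_def det_mul map_matrix_cnj_mult matrix_mul_assoc)
next
  show "\<one>\<^bsub>SUstar6\<^esub> \<in> carrier SUstar6"
    by (simp add: SUstar6_def map_matrix_cnj_one)
next
  fix A assume A: "A \<in> carrier SUstar6"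
  then have "invertible A" by (simp add: SUstar6_def invertible_det_nz)
  then obtain B where AB: "A ** B = mat 1" and BA: "B ** A = mat 1"
    unfolding invertible_def by blast
  have "det B = 1"
    using A arg_cong[OF BA, of det] by (simp add: SUstar6_def det_mul)
  have BAc: "map_matrix cnj B ** map_matrix cnj A = mat 1"
    by (metis BA map_matrix_cnj_mult map_matrix_cnj_one)
  have "Jmat ** B = map_matrix cnj B ** (map_matrix cnj A ** Jmat) ** B"
    by (simp add: matrix_mul_assoc BAc)
  also have "\<dots> = map_matrix cnj B ** (Jmat ** A) ** B"
    using A by (simp add: SUstar6_def)
  also have "\<dots> = map_matrix cnj B ** Jmat"
    by (simp add: AB flip: matrix_mul_assoc)
  finally show "\<exists>B\<in>carrier SUstar6. B \<otimes>\<^bsub>SUstar6\<^esub> A = \<one>\<^bsub>SUstar6\<^esub>"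
    using BA \<open>det B = 1\<close> by (auto simp: SUstar6_def)
qed (simp_all add: SUstar6_def matrix_mul_assoc)

lemma uminus_matrix_mult:
  fixes A B :: "complex^6^6"
  shows "(- A) ** B = - (A ** B)" "A ** (- B) = - (A ** B)"
  by (simp_all add: vec_eq_iff matrix_matrix_mult_def sum_negf)

lemma uminus_one_SUstar6: "- mat 1 \<in> carrier SUstar6"
proof -
  have "det (- mat 1 :: complex^6^6) = (\<Prod>i\<in>UNIV. (- mat 1 :: complex^6^6) $ i $ i)"
    by (rule det_diagonal) (simp add: mat_def)
  also have "\<dots> = 1"
    by (simp add: mat_def)
  finally have "det (- mat 1 :: complex^6^6) = 1" .
  moreover have "map_matrix cnj (- mat 1 :: complex^6^6) = - mat 1"
    by (simp add: vec_eq_iff mat_def)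
  ultimately show ?thesis
    by (simp add: SUstar6_def uminus_matrix_mult)
qed

lemma normal_pm_one: "{mat 1, - mat 1} \<lhd> SUstar6"
proof -
  interpret G: group SUstar6 by (rule group_SUstar6)
  have m: "(- mat 1) \<otimes>\<^bsub>SUstar6\<^esub> (- mat 1) = \<one>\<^bsub>SUstar6\<^esub>"
    by (simp add: SUstar6_def uminus_matrix_mult)
  have one: "mat 1 = \<one>\<^bsub>SUstar6\<^esub>" by (simp add: SUstar6_def)
  have "subgroup {mat 1, - mat 1} SUstar6"
  proof (rule G.subgroupI)
    show "{mat 1, - mat 1} \<subseteq> carrier SUstar6"
      using uminus_one_SUstar6 G.one_closed by (simp add: one)
    show "inv\<^bsub>SUstar6\<^esub> a \<in> {mat 1, - mat 1}" if "a \<in> {mat 1, - mat 1}" for a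
      using that G.inv_equality[OF m uminus_one_SUstar6 uminus_one_SUstar6] one by auto
    show "a \<otimes>\<^bsub>SUstar6\<^esub> b \<in> {mat 1, - mat 1}"
      if "a \<in> {mat 1, - mat 1}" "b \<in> {mat 1, - mat 1}" for a b
      using that by (auto simp: SUstar6_def uminus_matrix_mult)
  qed simp
  moreover have "x \<otimes>\<^bsub>SUstar6\<^esub> h \<otimes>\<^bsub>SUstar6\<^esub> inv\<^bsub>SUstar6\<^esub> x \<in> {mat 1, - mat 1}"
    if x: "x \<in> carrier SUstar6" and h: "h \<in> {mat 1, - mat 1}" for x h
  proof -
    have "x \<otimes>\<^bsub>SUstar6\<^esub> h = h \<otimes>\<^bsub>SUstar6\<^esub> x"
      using h by (auto simp: SUstar6_def uminus_matrix_mult)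
    moreover have "h \<in> carrier SUstar6"
      using h uminus_one_SUstar6 G.one_closed one by auto
    ultimately show ?thesis
      using x h by (simp add: G.m_assoc)
  qed
  ultimately show ?thesis
    by (simp add: G.normal_inv_iff)
qed

end

(*
  The group M_3(H) acts on Hermitian matrices by X |-> A X A', where A' is the conjugate transpose.
  Every A is a product of transvections and diagonal matrices, and on these one checks that
  det (A X A') = c det X where c is the determinant of the complex 6 x 6 form of A. So SU^*(6)
  maps to the group of det-preserving maps, with kernel {1, -1}.

  For surjectivity, the elements of rank at most one, +v v' or -v v', are those at which the
  second derivative of det vanishes, so a det-preserving map sends the three diagonal idempotents
  to such elements. After composing with the action of a matrix it fixes the diagonal up to signs;
  comparing the coefficients of det shows that the signs are 1 and that it acts on the
  off-diagonal entries by isometries b1, b2, b3 with Re (b1 x b2 y b3 z) = Re (x y z). Such a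
  triple comes from a diagonal matrix of unit quaternions because all automorphisms of H are inner.
*)

theory Submission
  imports Defs
begin


section \<open>Quaternions\<close>

lemma quat_sel_simps [simp]:
  "qre 0 = 0" "qi 0 = 0" "qj 0 = 0" "qk 0 = 0"
  "qre 1 = 1" "qi 1 = 0" "qj 1 = 0" "qk 1 = 0"
  "qre (x + y) = qre x + qre y" "qi (x + y) = qi x + qi y"
  "qj (x + y) = qj x + qj y" "qk (x + y) = qk x + qk y"
  "qre (x - y) = qre x - qre y" "qi (x - y) = qi x - qi y"
  "qj (x - y) = qj x - qj y" "qk (x - y) = qk x - qk y"
  "qre (- x) = - qre x" "qi (- x) = - qi x" "qj (- x) = - qj x" "qk (- x) = - qk x"
  "qre (r *\<^sub>R x) = r * qre x" "qi (r *\<^sub>R x) = r * qi x"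
  "qj (r *\<^sub>R x) = r * qj x" "qk (r *\<^sub>R x) = r * qk x"
  "qre (of_real r) = r" "qi (of_real r) = 0" "qj (of_real r) = 0" "qk (of_real r) = 0"
  "qre (qcnj x) = qre x" "qi (qcnj x) = - qi x" "qj (qcnj x) = - qj x" "qk (qcnj x) = - qk x"
  by (simp_all add: zero_quat_def one_quat_def plus_quat_def minus_quat_def uminus_quat_def
      scaleR_quat_def of_real_quat qcnj_def)

lemma quat_sel_times [simp]:
  "qre (x * y) = qre x * qre y - qi x * qi y - qj x * qj y - qk x * qk y"
  "qi (x * y) = qre x * qi y + qi x * qre y + qj x * qk y - qk x * qj y"
  "qj (x * y) = qre x * qj y - qi x * qk y + qj x * qre y + qk x * qi y"
  "qk (x * y) = qre x * qk y + qi x * qj y - qj x * qi y + qk x * qre y"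
  by (simp_all add: times_quat_def)

lemma quat_sel_numeral [simp]:
  "qre (numeral n) = numeral n" "qi (numeral n) = 0" "qj (numeral n) = 0" "qk (numeral n) = 0"
  using quat_sel_simps(25-28)[of "numeral n"] by simp_all

definition qnorm2 :: "quat \<Rightarrow> real" where
  "qnorm2 x = (qre x)\<^sup>2 + (qi x)\<^sup>2 + (qj x)\<^sup>2 + (qk x)\<^sup>2"

lemma qnorm2_nonneg: "0 \<le> qnorm2 x"
  by (simp add: qnorm2_def)

lemma qnorm2_eq_0_iff [simp]: "qnorm2 x = 0 \<longleftrightarrow> x = 0"
proof -
  have "x = 0" if "qnorm2 x = 0"
    using that unfolding qnorm2_def quat_eq_iff
    by (simp add: add_nonneg_eq_0_iff)
  then show ?thesis
    by (auto simp: qnorm2_def)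
qed

instantiation quat :: real_div_algebra
begin

definition inverse_quat :: "quat \<Rightarrow> quat" where
  "inverse_quat x = (1 / qnorm2 x) *\<^sub>R qcnj x"

definition divide_quat :: "quat \<Rightarrow> quat \<Rightarrow> quat" where
  "divide_quat x y = x * inverse y"

instance
proof
  fix x :: quat
  assume "x \<noteq> 0"
  then have "qnorm2 x \<noteq> 0"
    by simp
  moreover have "qcnj x * x = of_real (qnorm2 x)" "x * qcnj x = of_real (qnorm2 x)"
    by (simp_all add: quat_eq_iff qnorm2_def power2_eq_square algebra_simps)
  ultimately show "inverse x * x = 1" "x * inverse x = 1"
    by (simp_all add: inverse_quat_def quat_eq_iff)
next
  show "inverse (0::quat) = 0"
    by (simp add: inverse_quat_def quat_eq_iff)
qed (rule divide_quat_def)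

end

lemma qcnj_simps [simp]:
  "qcnj (x + y) = qcnj x + qcnj y" "qcnj (x - y) = qcnj x - qcnj y"
  "qcnj (- x) = - qcnj x" "qcnj (x * y) = qcnj y * qcnj x" "qcnj (qcnj x) = x"
  "qcnj 0 = 0" "qcnj 1 = 1" "qcnj (of_real r) = of_real r"
  "qcnj (r *\<^sub>R x) = r *\<^sub>R qcnj x"
  by (simp_all add: quat_eq_iff algebra_simps)

lemma qcnj_eq_0_iff [simp]: "qcnj x = 0 \<longleftrightarrow> x = 0"
  by (auto simp: quat_eq_iff)

lemma qcnj_sum: "qcnj (sum f S) = (\<Sum>i\<in>S. qcnj (f i))"
  by (induction S rule: infinite_finite_induct) auto

lemma mult_qcnj: "x * qcnj x = of_real (qnorm2 x)" "qcnj x * x = of_real (qnorm2 x)"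
  by (simp_all add: quat_eq_iff qnorm2_def power2_eq_square algebra_simps)

lemma qnorm2_mult: "qnorm2 (x * y) = qnorm2 x * qnorm2 y"
  by (simp add: qnorm2_def power2_eq_square algebra_simps)

lemma qnorm2_simps [simp]: "qnorm2 (qcnj x) = qnorm2 x" "qnorm2 0 = 0" "qnorm2 1 = 1"
  "qnorm2 (of_real r) = r\<^sup>2"
  by (simp_all add: qnorm2_def)

text \<open>Used to diagonalize the complex 2 by 2 block of a quaternion: its determinant can then
  be read off from a complex number and its conjugate.\<close>

lemma quat_conjugate_to_complex:
  obtains s where "s \<noteq> 0"
    "q * s = s * Quat (qre q) (sqrt ((qi q)\<^sup>2 + (qj q)\<^sup>2 + (qk q)\<^sup>2)) 0 0"
proof -
  define n where "n = sqrt ((qi q)\<^sup>2 + (qj q)\<^sup>2 + (qk q)\<^sup>2)"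
  have n2: "n * n = qi q * qi q + qj q * qj q + qk q * qk q"
    by (simp add: n_def flip: power2_eq_square)
  \<comment> \<open>With \<open>v\<close> the imaginary part of \<open>q\<close>, so that
    \<open>v * v = - n^2\<close>, the element \<open>v + n i\<close> satisfies
    \<open>v * s = s * (n i)\<close>. It vanishes only for \<open>v = - n i\<close>, where
    \<open>j\<close> works because it anticommutes with \<open>i\<close>.\<close>
  define s where "s = (if Quat 0 (qi q + n) (qj q) (qk q) = 0 then Quat 0 0 1 0
                       else Quat 0 (qi q + n) (qj q) (qk q))"
  have "s \<noteq> 0"
    by (simp add: s_def quat_eq_iff)
  moreover have "q * s = s * Quat (qre q) n 0 0"
    using n2 by (auto simp: s_def quat_eq_iff algebra_simps)
  ultimately show ?thesis
    using that by (simp add: n_def)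
qed

text \<open>
  Skolem--Noether by averaging: \<open>u\<close> below is the standard intertwiner applied to \<open>w\<close>; the
  sum of \<open>u(w) * qcnj w\<close> over the basis is \<open>4\<close>, so some choice of \<open>w\<close> works.
\<close>

lemma quat_automorphism_inner:
  assumes lin: "linear f" and mult: "\<And>x y. f (x * y) = f x * f y" and one: "f 1 = 1"
  obtains u where "qnorm2 u = 1" "\<And>x. f x = u * x * qcnj u"
proof -
  define i where "i = Quat 0 1 0 0"
  define j where "j = Quat 0 0 1 0"
  define k where "k = Quat 0 0 0 1"
  note ijk = i_def j_def k_def
  define I where "I = f i"
  define J where "J = f j"
  have "i * i = -1" "j * j = -1" "j * i = - (i * j)" and k: "k = i * j"
    by (simp_all add: ijk quat_eq_iff)
  then have I2: "I * I = -1" and J2: "J * J = -1" and JI: "J * I = - (I * J)"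
    unfolding I_def J_def using one by (metis mult linear_neg[OF lin])+
  \<comment> \<open>This is the sum of \<open>f e * w * e^-1\<close> over the units
    \<open>e = 1, i, j, k\<close>. Left multiplication by \<open>I\<close> or \<open>J\<close>
    permutes the terms up to the matching right factor, which gives \<open>UI\<close> and
    \<open>UJ\<close>.\<close>
  define U where "U w = w - I * w * i - J * w * j - I * J * w * k" for w
  have I2': "I * (I * z) = - z" and J2': "J * (J * z) = - z" and JI': "J * (I * z) = - (I * (J * z))" for z
    using I2 J2 JI by (simp_all flip: mult.assoc)
  have UI: "I * U w = U w * i" for w
  proof -
    have "i * i = -1" "j * i = - k" "k * i = j"
      by (simp_all add: ijk quat_eq_iff)
    then show ?thesis
      by (simp add: U_def algebra_simps I2' mult.assoc)
  qed
  have UJ: "J * U w = U w * j" for w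
  proof -
    have "j * j = -1" "i * j = k" "k * j = - i"
      by (simp_all add: ijk quat_eq_iff)
    then show ?thesis
      by (simp add: U_def algebra_simps I2' J2' JI' mult.assoc)
  qed
  \<comment> \<open>The sum of \<open>w * x * qcnj w\<close> over the four units \<open>w\<close> is
    4 times the real part of \<open>x\<close>, so only the term \<open>e = 1\<close> of
    \<open>U\<close> survives.\<close>
  have "U 1 - U i * i - U j * j - U k * k = 4"
    by (simp add: U_def ijk quat_eq_iff algebra_simps)
  then obtain w where w: "U w \<noteq> 0"
    by fastforce
  define u where "u = (1 / sqrt (qnorm2 (U w))) *\<^sub>R U w"
  have pos: "qnorm2 (U w) > 0"
    using w qnorm2_nonneg[of "U w"] by (simp add: less_le)
  have "qnorm2 u = (1 / sqrt (qnorm2 (U w)))\<^sup>2 * qnorm2 (U w)"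
    by (simp only: u_def qnorm2_def) (simp add: power_mult_distrib distrib_left power_divide)
  with w have nu: "qnorm2 u = 1"
    using qnorm2_nonneg by (simp add: power_divide)
  then have uu: "u * qcnj u = 1" "qcnj u * u = 1"
    by (simp_all add: mult_qcnj)
  have uI: "I * u = u * i" "J * u = u * j"
    using UI UJ by (simp_all add: u_def)
  have "f x = u * x * qcnj u" for x
  proof -
    have "x = qre x *\<^sub>R 1 + qi x *\<^sub>R i + qj x *\<^sub>R j + qk x *\<^sub>R (i * j)"
      by (simp add: ijk quat_eq_iff)
    then have fx: "f x = qre x *\<^sub>R 1 + qi x *\<^sub>R I + qj x *\<^sub>R J + qk x *\<^sub>R (I * J)"
      unfolding I_def J_def by (metis linear_add[OF lin] linear_scale[OF lin] mult one)
    have "f x * u = qre x *\<^sub>R u + qi x *\<^sub>R (I * u) + qj x *\<^sub>R (J * u) + qk x *\<^sub>R (I * (J * u))"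
      by (simp add: fx algebra_simps)
    also have "I * (J * u) = u * (i * j)"
      by (metis uI mult.assoc)
    also have "qre x *\<^sub>R u + qi x *\<^sub>R (I * u) + qj x *\<^sub>R (J * u) + qk x *\<^sub>R (u * (i * j)) = 
        u * (qre x *\<^sub>R 1 + qi x *\<^sub>R i + qj x *\<^sub>R j + qk x *\<^sub>R (i * j))"
      by (simp add: uI algebra_simps)
    also have "\<dots> = u * x"
      by (subst \<open>x = _\<close>[symmetric]) simp
    finally show ?thesis
      by (metis uu(1) mult.assoc mult.right_neutral)
  qed
  with nu that show ?thesis
    by blast
qed

lemma quat_central_unit:
  assumes "\<And>x. d * x = x * d" "qnorm2 d = 1"
  shows "d = 1 \<or> d = -1"
proof -
  have "qi d = 0" "qj d = 0" "qk d = 0"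
    using assms(1)[of "Quat 0 1 0 0"] assms(1)[of "Quat 0 0 1 0"] by (auto simp: quat_eq_iff)
  then show ?thesis
    using assms(2) by (auto simp: qnorm2_def quat_eq_iff power2_eq_1_iff)
qed



section \<open>The action of quaternionic matrices\<close>

lemma hadj_nth: "hadj A $ i $ j = qcnj (A $ j $ i)"
  by (simp add: hadj_def transpose_def)

lemma hadj_hadj [simp]: "hadj (hadj A) = A"
  by (simp add: vec_eq_iff hadj_nth)

lemma hadj_mult: "hadj (A ** B) = hadj B ** hadj A"
  by (simp add: vec_eq_iff hadj_nth matrix_matrix_mult_def qcnj_sum)

lemma hadj_mat_1 [simp]: "hadj (mat 1) = mat 1"
  by (simp add: vec_eq_iff hadj_nth mat_def)

definition herm_act :: "quat^3^3 \<Rightarrow> quat^3^3 \<Rightarrow> quat^3^3" where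
  "herm_act A X = A ** X ** hadj A"

lemma herm_act_mult: "herm_act (A ** B) X = herm_act A (herm_act B X)"
  by (simp add: herm_act_def hadj_mult matrix_mul_assoc)

lemma herm_act_mat_1 [simp]: "herm_act (mat 1) X = X"
  by (simp add: herm_act_def)

lemma herm_act_J3H: "X \<in> J3H \<Longrightarrow> herm_act A X \<in> J3H"
  by (simp add: J3H_def herm_act_def hadj_mult matrix_mul_assoc)

lemma matrix_mult_scaleR:
  fixes A B :: "quat^3^3"
  shows "(c *\<^sub>R A) ** B = c *\<^sub>R (A ** B)" "A ** (c *\<^sub>R B) = c *\<^sub>R (A ** B)"
  by (simp_all add: vec_eq_iff matrix_matrix_mult_def scaleR_right.sum)

lemma herm_act_add: "herm_act A (X + Y) = herm_act A X + herm_act A Y"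
  by (simp add: herm_act_def vec_eq_iff matrix_matrix_mult_def sum.distrib algebra_simps)

lemma herm_act_scaleR: "herm_act A (c *\<^sub>R X) = c *\<^sub>R herm_act A X"
  by (simp add: herm_act_def matrix_mult_scaleR)

lemma herm3_nth [simp]:
  "herm3 a b c x y z $ 1 $ 1 = of_real a" "herm3 a b c x y z $ 1 $ 2 = z"
  "herm3 a b c x y z $ 1 $ 3 = qcnj y" "herm3 a b c x y z $ 2 $ 1 = qcnj z"
  "herm3 a b c x y z $ 2 $ 2 = of_real b" "herm3 a b c x y z $ 2 $ 3 = x"
  "herm3 a b c x y z $ 3 $ 1 = y" "herm3 a b c x y z $ 3 $ 2 = qcnj x"
  "herm3 a b c x y z $ 3 $ 3 = of_real c"
  by (simp_all add: herm3_def)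

lemma herm3_in_J3H [simp]: "herm3 a b c x y z \<in> J3H"
  unfolding J3H_iff by blast

lemma J3H_cases:
  assumes "X \<in> J3H"
  obtains a b c x y z where "X = herm3 a b c x y z"
  using assms unfolding J3H_iff by blast

lemma detJ_herm3:
  "detJ (herm3 a b c x y z) =
     a * b * c + 2 * qre (x * y * z) - (a * qnorm2 x + b * qnorm2 y + c * qnorm2 z)"
  by (simp add: detJ_def qnorm2_def power2_eq_square algebra_simps)

definition qdiag :: "quat^3 \<Rightarrow> quat^3^3" where
  "qdiag d = (\<chi> i j. if i = j then d $ i else 0)"

lemma herm_act_qdiag:
  "herm_act (qdiag d) (herm3 a b c x y z) =
    herm3 (qnorm2 (d $ 1) * a) (qnorm2 (d $ 2) * b) (qnorm2 (d $ 3) * c)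
      (d $ 2 * x * qcnj (d $ 3)) (d $ 3 * y * qcnj (d $ 1)) (d $ 1 * z * qcnj (d $ 2))"
  by (simp add: vec_eq_iff forall_3 herm_act_def matrix_matrix_mult_def sum_3 qdiag_def hadj_nth
      mult.assoc)
    (simp add: quat_eq_iff qnorm2_def power2_eq_square algebra_simps)

lemma qre_conjugate: "qre (p * q * qcnj p) = qnorm2 p * qre q"
  by (simp add: qnorm2_def power2_eq_square algebra_simps)

lemma detJ_qdiag_act:
  assumes "X \<in> J3H"
  shows "detJ (herm_act (qdiag d) X) = qnorm2 (d $ 1) * qnorm2 (d $ 2) * qnorm2 (d $ 3) * detJ X"
proof -
  obtain a b c x y z where X: "X = herm3 a b c x y z"
    using assms by (rule J3H_cases)
  have re: "qre ((d $ 2 * x * qcnj (d $ 3)) * (d $ 3 * y * qcnj (d $ 1)) * (d $ 1 * z * qcnj (d $ 2)))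
      = qnorm2 (d $ 1) * qnorm2 (d $ 2) * qnorm2 (d $ 3) * qre (x * y * z)"
  proof -
    \<comment> \<open>The inner factors pair up to real norms; what remains is a conjugation by
      \<open>d $ 2\<close>, which scales the real part by a norm.\<close>
    have "(d $ 2 * x * qcnj (d $ 3)) * (d $ 3 * y * qcnj (d $ 1)) * (d $ 1 * z * qcnj (d $ 2))
        = d $ 2 * (x * (qcnj (d $ 3) * d $ 3) * y * (qcnj (d $ 1) * d $ 1) * z) * qcnj (d $ 2)"
      by (simp add: mult.assoc)
    also have "\<dots> = (qnorm2 (d $ 3) * qnorm2 (d $ 1)) *\<^sub>R (d $ 2 * (x * y * z) * qcnj (d $ 2))"
      by (simp add: mult_qcnj of_real_def)
    finally show ?thesis
      by (simp only: quat_sel_simps qre_conjugate) (simp only: mult.commute mult.left_commute)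
  qed
  show ?thesis
    unfolding X herm_act_qdiag detJ_herm3 re qnorm2_mult qnorm2_simps
    by (simp only: algebra_simps)
qed

section \<open>Transvections and reduction to diagonal form\<close>

definition transv :: "3 \<Rightarrow> 3 \<Rightarrow> quat \<Rightarrow> quat^3^3" where
  "transv i j q = (\<chi> r s. if r = s then 1 else if r = i \<and> s = j then q else 0)"

lemma transv_mult_nth:
  assumes "i \<noteq> j"
  shows "(transv i j q ** A) $ r $ s = A $ r $ s + (if r = i then q * A $ j $ s else 0)"
proof -
  have "(transv i j q ** A) $ r $ s =
      (\<Sum>k\<in>UNIV. (if k = r then A $ k $ s else 0) + (if k = j then if r = i then q * A $ k $ s else 0 else 0))"
    unfolding matrix_matrix_mult_def transv_def using assms by (auto intro!: sum.cong)
  then show ?thesis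
    by (simp add: sum.distrib)
qed

lemma mult_transv_nth:
  assumes "i \<noteq> j"
  shows "(A ** transv i j q) $ r $ s = A $ r $ s + (if s = j then A $ r $ i * q else 0)"
proof -
  have "(A ** transv i j q) $ r $ s =
      (\<Sum>k\<in>UNIV. (if k = s then A $ r $ k else 0) + (if k = i then if s = j then A $ r $ k * q else 0 else 0))"
    unfolding matrix_matrix_mult_def transv_def using assms by (auto intro!: sum.cong)
  then show ?thesis
    by (simp add: sum.distrib)
qed

lemma transv_inverse:
  assumes "i \<noteq> j"
  shows "transv i j q ** transv i j (- q) = mat 1" "transv i j (- q) ** transv i j q = mat 1"
  using assms by (auto simp: vec_eq_iff transv_mult_nth) (auto simp: transv_def mat_def)

lemma detJ_herm3_cyclic: "detJ (herm3 a b c x y z) = detJ (herm3 b c a y z x)"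
  by (simp add: detJ_herm3 algebra_simps)

text \<open>The changed entries are those of the action of \<open>transv 1 2 q\<close>, and in the
  next lemma those of \<open>transv 2 1 q\<close>. Cyclic relabelling turns these two cases into all
  six pairs of distinct indices.\<close>

lemma detJ_row_operation_upper:
  "detJ (herm3 (a + 2 * qre (q * qcnj z) + b * qnorm2 q) b c x (y + qcnj x * qcnj q) (z + b *\<^sub>R q))
     = detJ (herm3 a b c x y z)"
  by (simp add: detJ_herm3 qnorm2_def power2_eq_square algebra_simps)

lemma detJ_row_operation_lower:
  "detJ (herm3 a (b + 2 * qre (q * z) + a * qnorm2 q) c (x + q * qcnj y) y (z + a *\<^sub>R qcnj q))
     = detJ (herm3 a b c x y z)"
  by (simp add: detJ_herm3 qnorm2_def power2_eq_square algebra_simps)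

lemma detJ_transv_act:
  assumes "i \<noteq> j" and "X \<in> J3H"
  shows "detJ (herm_act (transv i j q) X) = detJ X"
proof -
  obtain a b c x y z where X: "X = herm3 a b c x y z"
    using \<open>X \<in> J3H\<close> by (rule J3H_cases)
  have h: "herm_act (transv i j q) X $ r $ s = X $ r $ s + (if r = i then q * X $ j $ s else 0)
      + (if s = i then (X $ r $ j + (if r = i then q * X $ j $ j else 0)) * qcnj q else 0)" for r s
  proof -
    have "hadj (transv i j q) = transv j i (qcnj q)"
      by (auto simp: vec_eq_iff hadj_nth transv_def)
    then show ?thesis
      using assms by (simp add: herm_act_def mult_transv_nth transv_mult_nth)
  qed
  \<comment> \<open>The new diagonal entry: the two cross terms are conjugate to each other, so
    together they give twice a real part. The two versions serve an off-diagonal entry stored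
    directly or as its conjugate.\<close>
  have self: "of_real t + q * p + (qcnj p + b *\<^sub>R q) * qcnj q
      = of_real (t + 2 * qre (q * p) + b * qnorm2 q)" for t b p
    by (simp add: quat_eq_iff qnorm2_def power2_eq_square algebra_simps)
  have self': "of_real t + q * qcnj p + (p + b *\<^sub>R q) * qcnj q
      = of_real (t + 2 * qre (q * qcnj p) + b * qnorm2 q)" for t b p
    by (simp add: quat_eq_iff qnorm2_def power2_eq_square algebra_simps)
  have scal: "q * of_real b = b *\<^sub>R q" "of_real b * q = b *\<^sub>R q" for b q
    by (simp_all add: of_real_def)
  consider "i = 1 \<and> j = 2" | "i = 2 \<and> j = 3" | "i = 3 \<and> j = 1"
    | "i = 2 \<and> j = 1" | "i = 3 \<and> j = 2" | "i = 1 \<and> j = 3"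
    using \<open>i \<noteq> j\<close> exhaust_3[of i] exhaust_3[of j] by auto
  then show ?thesis
  proof cases
    case 1
    then have "herm_act (transv i j q) X =
        herm3 (a + 2 * qre (q * qcnj z) + b * qnorm2 q) b c x (y + qcnj x * qcnj q) (z + b *\<^sub>R q)"
      unfolding vec_eq_iff forall_3 h unfolding X herm3_nth
      by (simp add: self self' scal del: quat_sel_times)
    then show ?thesis
      by (simp only: X detJ_row_operation_upper)
  next
    case 2
    then have "herm_act (transv i j q) X =
        herm3 a (b + 2 * qre (q * qcnj x) + c * qnorm2 q) c (x + c *\<^sub>R q) y (z + qcnj y * qcnj q)"
      unfolding vec_eq_iff forall_3 h unfolding X herm3_nth
      by (simp add: self self' scal del: quat_sel_times)
    then show ?thesis
      by (simp only: X detJ_herm3_cyclic[of a] detJ_row_operation_upper)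
  next
    case 3
    then have "herm_act (transv i j q) X =
        herm3 a b (c + 2 * qre (q * qcnj y) + a * qnorm2 q) (x + qcnj z * qcnj q) (y + a *\<^sub>R q) z"
      unfolding vec_eq_iff forall_3 h unfolding X herm3_nth
      by (simp add: self self' scal del: quat_sel_times)
    then show ?thesis
      using detJ_row_operation_upper[of c q y a b z x] by (simp only: X detJ_herm3_cyclic[of a b] detJ_herm3_cyclic[of b])
  next
    case 4
    then have "herm_act (transv i j q) X =
        herm3 a (b + 2 * qre (q * z) + a * qnorm2 q) c (x + q * qcnj y) y (z + a *\<^sub>R qcnj q)"
      unfolding vec_eq_iff forall_3 h unfolding X herm3_nth
      by (simp add: self self' scal del: quat_sel_times)
    then show ?thesis
      by (simp only: X detJ_row_operation_lower)
  next
    case 5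
    then have "herm_act (transv i j q) X =
        herm3 a b (c + 2 * qre (q * x) + b * qnorm2 q) (x + b *\<^sub>R qcnj q) (y + q * qcnj z) z"
      unfolding vec_eq_iff forall_3 h unfolding X herm3_nth
      by (simp add: self self' scal del: quat_sel_times)
    then show ?thesis
      by (simp only: X detJ_herm3_cyclic[of a] detJ_row_operation_lower)
  next
    case 6
    then have "herm_act (transv i j q) X =
        herm3 (a + 2 * qre (q * y) + c * qnorm2 q) b c x (y + c *\<^sub>R qcnj q) (z + q * qcnj x)"
      unfolding vec_eq_iff forall_3 h unfolding X herm3_nth
      by (simp add: self self' scal del: quat_sel_times)
    then show ?thesis
      using detJ_row_operation_lower[of c a q y b z x] by (simp only: X detJ_herm3_cyclic[of _ b c] detJ_herm3_cyclic[of b])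
  qed
qed

text \<open>Gaussian elimination over a division ring, phrased as an induction principle. Zero
  pivots are repaired by adding another row or column, so no permutation matrices occur and singular
  matrices are covered. Row multipliers carry the inverse pivot on the right, column multipliers on
  the left.\<close>

lemma matrix_diagonalization:
  assumes diag: "\<And>d. P (qdiag d)"
    and left: "\<And>i j q A. i \<noteq> j \<Longrightarrow> P (transv i j q ** A) \<Longrightarrow> P A"
    and right: "\<And>i j q A. i \<noteq> j \<Longrightarrow> P (A ** transv i j q) \<Longrightarrow> P A"
  shows "P A"
proof -
  have diag': "P A" if "\<And>i j. i \<noteq> j \<Longrightarrow> A $ i $ j = 0" for A
  proof -
    have "A = qdiag (\<chi> i. A $ i $ i)"
      using that by (auto simp: qdiag_def vec_eq_iff)
    then show ?thesis
      using diag by metis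
  qed
  have n3: "(1::3) \<noteq> 2" "(2::3) \<noteq> 3" "(1::3) \<noteq> 3" "(2::3) \<noteq> 1" "(3::3) \<noteq> 2" "(3::3) \<noteq> 1"
    by simp_all
  have clear2: "P A" if "A $ 2 $ 2 \<noteq> 0" "A $ 1 $ 2 = 0" "A $ 1 $ 3 = 0" "A $ 2 $ 1 = 0" "A $ 3 $ 1 = 0" for A
    apply (rule left[where i = 3 and j = 2 and q = "- (A $ 3 $ 2) * inverse (A $ 2 $ 2)"], simp)
    apply (rule right[where i = 2 and j = 3 and q = "- inverse (A $ 2 $ 2) * A $ 2 $ 3"], simp)
    apply (rule diag')
    subgoal for i j
      using exhaust_3[of i] exhaust_3[of j] that
      by (elim disjE) (simp_all add: transv_mult_nth mult_transv_nth n3 mult.assoc, simp_all flip: mult.assoc)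
    done
  \<comment> \<open>Adding row 3 to row 2 moves the nonzero entry into the pivot position.\<close>
  have row2: "P A" if "A $ 3 $ 2 \<noteq> 0" "A $ 1 $ 2 = 0" "A $ 1 $ 3 = 0" "A $ 2 $ 1 = 0" "A $ 3 $ 1 = 0" for A
  proof (cases "A $ 2 $ 2 = 0")
    case True
    show ?thesis
      apply (rule left[where i = 2 and j = 3 and q = 1], simp)
      apply (rule clear2)
      using True that by (simp_all add: transv_mult_nth n3)
  qed (use clear2 that in blast)
  have block2: "P A" if "A $ 1 $ 2 = 0" "A $ 1 $ 3 = 0" "A $ 2 $ 1 = 0" "A $ 3 $ 1 = 0" for A
  proof (cases "A $ 2 $ 2 = 0 \<and> A $ 3 $ 2 = 0")
    case True
    show ?thesis
    proof (cases "A $ 2 $ 3 = 0")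
      case False
      \<comment> \<open>Column 2 of the block vanishes; adding column 3 to it creates the pivot
        \<open>A $ 2 $ 3\<close>.\<close>
      show ?thesis
        apply (rule right[where i = 3 and j = 2 and q = 1], simp)
        apply (rule clear2)
        using True False that by (simp_all add: mult_transv_nth n3)
    next
      case z: True
      show ?thesis
      proof (rule diag')
        fix i j :: 3 assume "i \<noteq> j"
        then show "A $ i $ j = 0"
          using exhaust_3[of i] exhaust_3[of j] that True z by auto
      qed
    qed
  qed (use clear2 row2 that in blast)
  have clear1: "P A" if "A $ 1 $ 1 \<noteq> 0" for A
    apply (rule left[where i = 2 and j = 1 and q = "- (A $ 2 $ 1) * inverse (A $ 1 $ 1)"], simp)
    apply (rule left[where i = 3 and j = 1 and q = "- (A $ 3 $ 1) * inverse (A $ 1 $ 1)"], simp)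
    apply (rule right[where i = 1 and j = 2 and q = "- inverse (A $ 1 $ 1) * A $ 1 $ 2"], simp)
    apply (rule right[where i = 1 and j = 3 and q = "- inverse (A $ 1 $ 1) * A $ 1 $ 3"], simp)
    apply (rule block2)
    using that by (simp_all add: transv_mult_nth mult_transv_nth n3 mult.assoc) (simp_all flip: mult.assoc)
  have col1: "P A" if "A $ i $ 1 \<noteq> 0" for A i
  proof (cases "A $ 1 $ 1 = 0")
    case True
    with that have "1 \<noteq> i"
      by auto
    show ?thesis
      apply (rule left[where i = 1 and j = i and q = 1], rule \<open>1 \<noteq> i\<close>)
      apply (rule clear1)
      using True that \<open>1 \<noteq> i\<close> by (simp add: transv_mult_nth)
  qed (use clear1 in blast)
  show ?thesis
  \<comment> \<open>If column 1 vanishes but some column \<open>j\<close> does not, column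
    \<open>j\<close> is added to column 1. Otherwise either column 1 is nonzero or the whole matrix
    is zero.\<close>
  proof (cases "\<exists>i j. A $ i $ j \<noteq> 0 \<and> (\<forall>i. A $ i $ 1 = 0)")
    case True
    then obtain i j where ij: "A $ i $ j \<noteq> 0" "\<And>i. A $ i $ 1 = 0"
      by blast
    then have "j \<noteq> 1"
      by auto
    show ?thesis
      apply (rule right[where i = j and j = 1 and q = 1], rule \<open>j \<noteq> 1\<close>)
      apply (rule col1[where i = i])
      using ij \<open>j \<noteq> 1\<close> by (simp add: mult_transv_nth)
  next
    case False
    then show ?thesis
      using col1 diag' by metis
  qed
qed


section \<open>The complex representation\<close>

lemma exhaust_6:
  fixes x :: 6
  shows "x = 1 \<or> x = 2 \<or> x = 3 \<or> x = 4 \<or> x = 5 \<or> x = 6"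
proof (induct x)
  case (of_int z)
  then have "0 \<le> z" and "z < 6" by simp_all
  \<comment> \<open>The representatives run from 0 to 5, and 0 is the element written
    \<open>6\<close>.\<close>
  then have "z = 0 \<or> z = 1 \<or> z = 2 \<or> z = 3 \<or> z = 4 \<or> z = 5" by arith
  then show ?case by auto
qed

lemma forall_6: "(\<forall>i::6. P i) \<longleftrightarrow> P 1 \<and> P 2 \<and> P 3 \<and> P 4 \<and> P 5 \<and> P 6"
  by (metis exhaust_6)

lemma UNIV_6: "UNIV = {1::6, 2, 3, 4, 5, 6}"
  using exhaust_6 by auto

lemma sum_6: "sum f (UNIV::6 set) = f 1 + f 2 + f 3 + f 4 + f 5 + f 6"
  unfolding UNIV_6 by (simp add: ac_simps)

lemma prod_6: "prod f (UNIV::6 set) = f 1 * f 2 * f 3 * f 4 * f 5 * f 6"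
  unfolding UNIV_6 by (simp add: ac_simps)

text \<open>
  The quaternion \<open>a + b j\<close> with \<open>a\<close>, \<open>b\<close> complex is represented by the block
  \<open>((a, b), (- cnj b, cnj a))\<close>; the flags tell whether the first row or column is meant.
\<close>

definition quat_block :: "quat \<Rightarrow> bool \<Rightarrow> bool \<Rightarrow> complex" where
  "quat_block q r s =
     (if r then if s then Complex (qre q) (qi q) else Complex (qj q) (qk q)
      else if s then Complex (- qj q) (qk q) else Complex (qre q) (- qi q))"

definition block_index :: "6 \<Rightarrow> 3" where
  "block_index r = (if r = 1 \<or> r = 2 then 1 else if r = 3 \<or> r = 4 then 2 else 3)"

definition block_first :: "6 \<Rightarrow> bool" where
  "block_first r \<longleftrightarrow> r = 1 \<or> r = 3 \<or> r = 5"

definition cmat :: "quat^3^3 \<Rightarrow> complex^6^6" where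
  "cmat A = (\<chi> r s. quat_block (A $ block_index r $ block_index s) (block_first r) (block_first s))"

lemma quat_block_mult:
  "quat_block (x * y) r s = quat_block x r True * quat_block y True s
     + quat_block x r False * quat_block y False s"
  by (simp add: quat_block_def complex_eq_iff algebra_simps)

lemma quat_block_add: "quat_block (x + y) r s = quat_block x r s + quat_block y r s"
  by (simp add: quat_block_def complex_eq_iff)

lemma block_index_simps:
  "block_index 1 = 1" "block_index 2 = 1" "block_index 3 = 2" "block_index 4 = 2"
  "block_index 5 = 3" "block_index 6 = 3"
  "block_first 1" "\<not> block_first 2" "block_first 3" "\<not> block_first 4"
  "block_first 5" "\<not> block_first 6"
  by (simp_all add: block_index_def block_first_def)

lemma cmat_mult: "cmat (A ** B) = cmat A ** cmat B"
  by (simp add: vec_eq_iff cmat_def matrix_matrix_mult_def sum_3 sum_6 block_index_simps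
      quat_block_add quat_block_mult add.assoc del: quat_sel_times)

lemma cmat_mat_1: "cmat (mat 1) = mat 1"
  by (simp add: vec_eq_iff forall_6 cmat_def mat_def block_index_simps quat_block_def complex_eq_iff)

lemma cmat_uminus: "cmat (- A) = - cmat A"
  by (simp add: vec_eq_iff cmat_def quat_block_def complex_eq_iff)

lemma quat_block_eq_iff: "x = y \<longleftrightarrow> quat_block x True True = quat_block y True True \<and>
    quat_block x True False = quat_block y True False"
  by (auto simp: quat_block_def quat_eq_iff)

lemma inj_cmat: "inj cmat"
proof (rule injI)
  fix A B
  assume "cmat A = cmat B"
  then have "cmat A $ r $ s = cmat B $ r $ s" for r s
    by simp
  then have e: "quat_block (A $ block_index r $ block_index s) (block_first r) (block_first s) =
      quat_block (B $ block_index r $ block_index s) (block_first r) (block_first s)" for r s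
    by (simp add: cmat_def)
  have ind: "\<exists>r. block_index r = i \<and> block_first r" "\<exists>r. block_index r = i \<and> \<not> block_first r" for i
    using exhaust_3[of i] block_index_simps by metis+
  have "A $ i $ j = B $ i $ j" for i j
  proof -
    obtain r s t where "block_index r = i" "block_first r" "block_index s = j" "block_first s"
      "block_index t = j" "\<not> block_first t"
      using ind by metis
    then show ?thesis
      using e[of r s] e[of r t] by (simp add: quat_block_eq_iff)
  qed
  then show "A = B"
    by (simp add: vec_eq_iff)
qed

section \<open>The image of the complex representation\<close>

lemma Jmat_mult_nth:
  "(Jmat ** B) $ 1 $ s = B $ 2 $ s" "(Jmat ** B) $ 2 $ s = - B $ 1 $ s"
  "(Jmat ** B) $ 3 $ s = B $ 4 $ s" "(Jmat ** B) $ 4 $ s = - B $ 3 $ s"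
  "(Jmat ** B) $ 5 $ s = B $ 6 $ s" "(Jmat ** B) $ 6 $ s = - B $ 5 $ s"
  by (simp_all add: matrix_matrix_mult_def sum_6 Jmat_def)

lemma mult_Jmat_nth:
  "(B ** Jmat) $ r $ 1 = - B $ r $ 2" "(B ** Jmat) $ r $ 2 = B $ r $ 1"
  "(B ** Jmat) $ r $ 3 = - B $ r $ 4" "(B ** Jmat) $ r $ 4 = B $ r $ 3"
  "(B ** Jmat) $ r $ 5 = - B $ r $ 6" "(B ** Jmat) $ r $ 6 = B $ r $ 5"
  by (simp_all add: matrix_matrix_mult_def sum_6 Jmat_def)

lemma Jmat_cmat: "Jmat ** cmat A = map_matrix cnj (cmat A) ** Jmat"
  unfolding vec_eq_iff forall_6 Jmat_mult_nth mult_Jmat_nth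
  by (simp add: cmat_def block_index_simps quat_block_def complex_eq_iff)

text \<open>The relation with \<open>Jmat\<close> expresses each even row through the conjugates of
  the preceding odd row, so every 2 by 2 block has the shape of a quaternion, recovered by
  \<open>q\<close> from its first row.\<close>

lemma range_cmat:
  assumes "Jmat ** B = map_matrix cnj B ** Jmat"
  shows "B \<in> range cmat"
proof -
  define q where "q z w = Quat (Re z) (Im z) (Re w) (Im w)" for z w
  define A :: "quat^3^3" where "A =
    vector [vector [q (B $ 1 $ 1) (B $ 1 $ 2), q (B $ 1 $ 3) (B $ 1 $ 4), q (B $ 1 $ 5) (B $ 1 $ 6)],
            vector [q (B $ 3 $ 1) (B $ 3 $ 2), q (B $ 3 $ 3) (B $ 3 $ 4), q (B $ 3 $ 5) (B $ 3 $ 6)],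
            vector [q (B $ 5 $ 1) (B $ 5 $ 2), q (B $ 5 $ 3) (B $ 5 $ 4), q (B $ 5 $ 5) (B $ 5 $ 6)]]"
  have e: "(Jmat ** B) $ r $ s = (map_matrix cnj B ** Jmat) $ r $ s" for r s
    using assms by simp
  have "B $ 2 $ 1 = - cnj (B $ 1 $ 2)" "B $ 2 $ 2 = cnj (B $ 1 $ 1)"
    "B $ 2 $ 3 = - cnj (B $ 1 $ 4)" "B $ 2 $ 4 = cnj (B $ 1 $ 3)"
    "B $ 2 $ 5 = - cnj (B $ 1 $ 6)" "B $ 2 $ 6 = cnj (B $ 1 $ 5)"
    "B $ 4 $ 1 = - cnj (B $ 3 $ 2)" "B $ 4 $ 2 = cnj (B $ 3 $ 1)"
    "B $ 4 $ 3 = - cnj (B $ 3 $ 4)" "B $ 4 $ 4 = cnj (B $ 3 $ 3)"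
    "B $ 4 $ 5 = - cnj (B $ 3 $ 6)" "B $ 4 $ 6 = cnj (B $ 3 $ 5)"
    "B $ 6 $ 1 = - cnj (B $ 5 $ 2)" "B $ 6 $ 2 = cnj (B $ 5 $ 1)"
    "B $ 6 $ 3 = - cnj (B $ 5 $ 4)" "B $ 6 $ 4 = cnj (B $ 5 $ 3)"
    "B $ 6 $ 5 = - cnj (B $ 5 $ 6)" "B $ 6 $ 6 = cnj (B $ 5 $ 5)"
    using e[of 1 1] e[of 1 2] e[of 1 3] e[of 1 4] e[of 1 5] e[of 1 6]
      e[of 3 1] e[of 3 2] e[of 3 3] e[of 3 4] e[of 3 5] e[of 3 6]
      e[of 5 1] e[of 5 2] e[of 5 3] e[of 5 4] e[of 5 5] e[of 5 6]
    by (simp_all add: Jmat_mult_nth mult_Jmat_nth)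
  then have "B = cmat A"
    unfolding vec_eq_iff forall_6
    by (simp add: cmat_def block_index_simps A_def q_def quat_block_def complex_eq_iff)
  then show ?thesis
    by blast
qed

section \<open>Determinants of the complex forms\<close>

lemma det_cmat_nonzero:
  assumes "A ** B = mat 1"
  shows "det (cmat A) \<noteq> 0"
proof -
  have "det (cmat A) * det (cmat B) = 1"
    using arg_cong[OF assms, of "\<lambda>A. det (cmat A)"]
    by (simp add: cmat_mult cmat_mat_1 det_mul)
  then show ?thesis
    by auto
qed

text \<open>A transvection is a commutator of transvections, so its determinant is \<open>1\<close>.\<close>

lemma det_cmat_transv:
  assumes "i \<noteq> j"
  shows "det (cmat (transv i j q)) = 1"
proof -
  have "i \<noteq> 1 \<and> 1 \<noteq> j \<or> i \<noteq> 2 \<and> 2 \<noteq> j \<or> i \<noteq> 3 \<and> 3 \<noteq> j"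
    using exhaust_3[of i] exhaust_3[of j] by (elim disjE) simp_all
  then obtain k where k: "i \<noteq> k" "k \<noteq> j"
    by blast
  \<comment> \<open>Determinants commute, so in the commutator each transvection can be paired with
    its inverse, and each pair contributes 1.\<close>
  have d: "det (cmat (transv r s p)) * det (cmat (transv r s (- p))) = 1" if "r \<noteq> s" for r s p
    using arg_cong[OF transv_inverse(1)[OF that, of p], of "\<lambda>A. det (cmat A)"]
    unfolding cmat_mult cmat_mat_1 det_mul det_I .
  have comm: "transv i k q ** (transv k j 1 ** (transv i k (- q) ** transv k j (- 1))) = transv i j q"
  proof -
    have kj: "j \<noteq> k" "k \<noteq> i" "j \<noteq> i"
      using k assms by auto
    have "(transv i k q ** (transv k j 1 ** (transv i k (- q) ** transv k j (- 1)))) $ r $ s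
        = transv i j q $ r $ s" for r s
      unfolding transv_mult_nth[OF k(1)] transv_mult_nth[OF k(2)]
      using k kj assms by (simp add: transv_def del: quat_sel_times)
    then show ?thesis
      by (simp add: vec_eq_iff)
  qed
  have swap: "a * (b * (c * d)) = e \<Longrightarrow> e = (a * c) * (b * d)" for a b c d e :: complex
    by (auto simp: mult_ac)
  have "det (cmat (transv i j q)) =
      (det (cmat (transv i k q)) * det (cmat (transv i k (- q)))) *
      (det (cmat (transv k j 1)) * det (cmat (transv k j (- 1))))"
    using arg_cong[OF comm, of "\<lambda>A. det (cmat A)"]
    unfolding cmat_mult cmat_mat_1 det_mul det_I
    by (rule swap)
  then show ?thesis
    unfolding d[OF k(1)] d[OF k(2)] by simp
qed

lemma qdiag_mult: "qdiag d ** qdiag e = qdiag (\<chi> i. d $ i * e $ i)"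
  by (simp add: vec_eq_iff forall_3 matrix_matrix_mult_def sum_3 qdiag_def del: quat_sel_times)

text \<open>Conjugating the entries into the complex numbers makes the 6 by 6 matrix diagonal.\<close>

lemma det_cmat_qdiag:
  "det (cmat (qdiag d)) = of_real (qnorm2 (d $ 1) * qnorm2 (d $ 2) * qnorm2 (d $ 3))"
proof -
  define c where
    "c q = Quat (qre q) (sqrt ((qi q)\<^sup>2 + (qj q)\<^sup>2 + (qk q)\<^sup>2)) 0 0" for q
  have "\<forall>i. \<exists>s. s \<noteq> 0 \<and> d $ i * s = s * c (d $ i)"
    unfolding c_def using quat_conjugate_to_complex by metis
  then obtain s where s: "\<And>i. s i \<noteq> 0" "\<And>i. d $ i * s i = s i * c (d $ i)"
    by metis
  define S where "S = qdiag (\<chi> i. s i)"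
  have "qdiag d ** S = S ** qdiag (\<chi> i. c (d $ i))"
    by (simp add: S_def qdiag_mult s(2))
  then have "det (cmat (qdiag d)) * det (cmat S) = det (cmat S) * det (cmat (qdiag (\<chi> i. c (d $ i))))"
    by (metis cmat_mult det_mul)
  moreover have "det (cmat S) \<noteq> 0"
  proof (rule det_cmat_nonzero)
    show "S ** qdiag (\<chi> i. inverse (s i)) = mat 1"
      using s(1) by (simp add: S_def qdiag_mult) (simp add: vec_eq_iff qdiag_def mat_def)
  qed
  ultimately have "det (cmat (qdiag d)) = det (cmat (qdiag (\<chi> i. c (d $ i))))"
    by simp
  also have "\<dots> = (\<Prod>r\<in>UNIV. cmat (qdiag (\<chi> i. c (d $ i))) $ r $ r)"
  proof (rule det_diagonal)
    have "\<forall>r t. r \<noteq> t \<longrightarrow> cmat (qdiag (\<chi> i. c (d $ i))) $ r $ t = 0"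
      unfolding forall_6
      by (simp add: cmat_def block_index_simps qdiag_def quat_block_def c_def complex_eq_iff)
    then show "cmat (qdiag (\<chi> i. c (d $ i))) $ r $ t = 0" if "r \<noteq> t" for r t
      using that by blast
  qed
  also have "\<dots> = of_real (qnorm2 (d $ 1) * qnorm2 (d $ 2) * qnorm2 (d $ 3))"
  proof -
    \<comment> \<open>The block of \<open>c q\<close> is diagonal with a complex number and its
      conjugate as entries; their product is the norm.\<close>
    have e: "quat_block (c q) True True * quat_block (c q) False False = of_real (qnorm2 q)" for q
      by (simp add: quat_block_def c_def qnorm2_def complex_eq_iff power2_eq_square flip: real_sqrt_mult)
    show ?thesis
      by (simp add: prod_6 cmat_def block_index_simps qdiag_def mult.assoc flip: e)
  qed
  finally show ?thesis .
qed

text \<open>The determinant of \<open>cmat A\<close> and the factor by which \<open>A\<close> scales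
  \<open>detJ\<close> are both multiplicative, so comparing them on diagonal matrices and
  transvections suffices. The bound \<open>c >= 0\<close>, coming from the norms in the diagonal
  case, later excludes \<open>c = -1\<close>.\<close>

lemma detJ_herm_act_cmat:
  "\<exists>c\<ge>0. det (cmat A) = of_real c \<and> (\<forall>X\<in>J3H. detJ (herm_act A X) = c * detJ X)"
proof (rule matrix_diagonalization[of _ A])
  fix d :: "quat^3"
  let ?c = "qnorm2 (d $ 1) * qnorm2 (d $ 2) * qnorm2 (d $ 3)"
  have "0 \<le> ?c"
    by (simp add: qnorm2_nonneg)
  then show "\<exists>c\<ge>0. det (cmat (qdiag d)) = of_real c \<and> (\<forall>X\<in>J3H. detJ (herm_act (qdiag d) X) = c * detJ X)"
    using det_cmat_qdiag[of d] detJ_qdiag_act[of _ d] by blast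
next
  fix i j :: 3 and q A
  assume ij: "i \<noteq> j"
  show "\<exists>c\<ge>0. det (cmat A) = of_real c \<and> (\<forall>X\<in>J3H. detJ (herm_act A X) = c * detJ X)"
    if "\<exists>c\<ge>0. det (cmat (transv i j q ** A)) = of_real c \<and>
      (\<forall>X\<in>J3H. detJ (herm_act (transv i j q ** A) X) = c * detJ X)"
    using that ij by (simp add: cmat_mult det_mul det_cmat_transv herm_act_mult detJ_transv_act herm_act_J3H)
  show "\<exists>c\<ge>0. det (cmat A) = of_real c \<and> (\<forall>X\<in>J3H. detJ (herm_act A X) = c * detJ X)"
    if h: "\<exists>c\<ge>0. det (cmat (A ** transv i j q)) = of_real c \<and>
      (\<forall>X\<in>J3H. detJ (herm_act (A ** transv i j q) X) = c * detJ X)"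
  proof -
    obtain c where c: "c \<ge> 0" "det (cmat A) = of_real c"
      and d: "\<And>X. X \<in> J3H \<Longrightarrow> detJ (herm_act A (herm_act (transv i j q) X)) = c * detJ X"
      using h unfolding cmat_mult det_mul det_cmat_transv[OF ij] herm_act_mult mult_1_right by blast
    \<comment> \<open>Every \<open>X\<close> is the image of an element of \<open>J3H\<close> under
      the transvection, and that element has the same \<open>detJ\<close>.\<close>
    have "detJ (herm_act A X) = c * detJ X" if X: "X \<in> J3H" for X
    proof -
      have "herm_act (transv i j q) (herm_act (transv i j (- q)) X) = X"
        using ij by (simp add: transv_inverse flip: herm_act_mult)
      then show ?thesis
        using d[OF herm_act_J3H[OF X]] X ij by (metis detJ_transv_act)
    qed
    then show ?thesis
      using c by blast
  qed
qed


section \<open>Determinant-preserving maps\<close>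

lemma qnorm2_diff: "qnorm2 (u - v) = qnorm2 u + qnorm2 v - 2 * qre (u * qcnj v)"
  by (simp add: qnorm2_def power2_eq_square algebra_simps)

text \<open>
  With \<open>g w = qcnj (b3 (qcnj w))\<close>, the quaternions \<open>b1 x * b2 y\<close> and \<open>g (x * y)\<close> have equal norms
  and attain equality in the Cauchy--Schwarz inequality, so they agree. Hence \<open>g\<close> is an
  automorphism up to a unit factor.
\<close>

lemma quat_triality:
  assumes lin: "linear b3"
    and n1: "\<And>x. qnorm2 (b1 x) = qnorm2 x" and n2: "\<And>x. qnorm2 (b2 x) = qnorm2 x"
    and n3: "\<And>x. qnorm2 (b3 x) = qnorm2 x"
    and tri: "\<And>x y z. qre (b1 x * b2 y * b3 z) = qre (x * y * z)"
  obtains d1 d2 d3 where "qnorm2 d1 = 1" "qnorm2 d2 = 1" "qnorm2 d3 = 1"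
    "\<And>x. b1 x = d2 * x * qcnj d3" "\<And>x. b2 x = d3 * x * qcnj d1" "\<And>x. b3 x = d1 * x * qcnj d2"
proof -
  define g where "g w = qcnj (b3 (qcnj w))" for w
  have g: "b1 x * b2 y = g (x * y)" for x y
  proof -
    have "qre (b1 x * b2 y * qcnj (g (x * y))) = qre (x * y * qcnj (x * y))"
      unfolding g_def using tri[of x y "qcnj (x * y)"] by (simp only: qcnj_simps)
    also have "\<dots> = qnorm2 (x * y)"
      by (simp only: mult_qcnj quat_sel_simps)
    finally have "qnorm2 (b1 x * b2 y - g (x * y)) = 0"
      unfolding qnorm2_diff by (simp add: g_def n1 n2 n3 qnorm2_mult del: quat_sel_times qnorm2_eq_0_iff)
    then show ?thesis
      by simp
  qed
  define a where "a = b1 1"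
  define b where "b = b2 1"
  have a: "a * qcnj a = 1" "qcnj a * a = 1" and b: "b * qcnj b = 1" "qcnj b * b = 1"
    by (simp_all add: a_def b_def mult_qcnj n1 n2 del: quat_sel_times)
  have a': "qcnj a * (a * x) = x" and b': "b * (qcnj b * x) = x" for x
    using a b by (simp_all flip: mult.assoc del: quat_sel_times)
  have b1: "b1 x = g x * qcnj b" and b2: "b2 x = qcnj a * g x" for x
  proof -
    have "b1 x * b = g x" "a * b2 x = g x"
      using g[of x 1] g[of 1 x] by (simp_all add: a_def b_def del: quat_sel_times)
    then show "b1 x = g x * qcnj b" "b2 x = qcnj a * g x"
      using b(1) a(2) by (metis mult.assoc mult.right_neutral, metis mult.assoc mult.left_neutral)
  qed
  \<comment> \<open>Since \<open>g 1 = a * b\<close> with \<open>a\<close>, \<open>b\<close> of norm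
    1, this divides \<open>g\<close> on the right by \<open>g 1\<close>.\<close>
  define f where "f x = g x * qcnj b * qcnj a" for x
  have "linear f"
  proof (rule linearI)
    show "f (x + y) = f x + f y" for x y
      unfolding f_def g_def by (simp only: qcnj_simps linear_add[OF lin] distrib_right)
    show "f (c *\<^sub>R x) = c *\<^sub>R f x" for c x
      unfolding f_def g_def by (simp only: qcnj_simps linear_scale[OF lin] mult_scaleR_left)
  qed
  moreover have "f (x * y) = f x * f y" for x y
    unfolding f_def g[symmetric] by (simp only: b1 b2 mult.assoc)
  moreover have "f 1 = 1"
  proof -
    have "g 1 = a * b"
      using g[of 1 1] by (simp add: a_def b_def del: quat_sel_times)
    then show ?thesis
      unfolding f_def using a(1) by (simp only: mult.assoc b')
  qed
  ultimately obtain u where u: "qnorm2 u = 1" "\<And>x. f x = u * x * qcnj u"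
    using quat_automorphism_inner by blast
  have gf: "g x = u * x * qcnj u * a * b" for x
  proof -
    have "g x = f x * a * b"
      unfolding f_def by (simp only: mult.assoc a' b mult.right_neutral)
    then show ?thesis
      by (simp only: u)
  qed
  show ?thesis
  \<comment> \<open>The three units are read off from \<open>g x = u * x * qcnj u * a * b\<close> by
    multiplying with \<open>qcnj b\<close> on the right for \<open>b1\<close>, with
    \<open>qcnj a\<close> on the left for \<open>b2\<close>, and by conjugating for
    \<open>b3\<close>.\<close>
  proof (rule that[of "qcnj b * qcnj a * u" u "qcnj a * u"])
    show "qnorm2 u = 1" "qnorm2 (qcnj a * u) = 1" "qnorm2 (qcnj b * qcnj a * u) = 1"
      by (simp_all only: qnorm2_mult qnorm2_simps u(1) a_def b_def n1 n2 mult_1_left)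
    show "b1 x = u * x * qcnj (qcnj a * u)" for x
      unfolding b1 gf qcnj_simps mult.assoc b mult.right_neutral ..
    show "b2 x = qcnj a * u * x * qcnj (qcnj b * qcnj a * u)" for x
      unfolding b2 gf qcnj_simps mult.assoc ..
    show "b3 x = qcnj b * qcnj a * u * x * qcnj u" for x
    proof -
      have "b3 x = qcnj (g (qcnj x))"
        by (simp add: g_def)
      then show ?thesis
        unfolding gf qcnj_simps mult.assoc .
    qed
  qed
qed

section \<open>Elements of rank at most one\<close>

definition outer :: "quat^3 \<Rightarrow> quat^3^3" where
  "outer v = (\<chi> i j. v $ i * qcnj (v $ j))"

text \<open>The square root of the absolute value of the factor is absorbed into the vector, which
  leaves only a sign.\<close>

lemma scaleR_outer:
  obtains s w where "s = 1 \<or> s = - 1" "r *\<^sub>R outer v = s *\<^sub>R outer w"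
proof
  let ?s = "if r < 0 then - 1 else 1 :: real"
  show "?s = 1 \<or> ?s = - 1"
    by simp
  show "r *\<^sub>R outer v = ?s *\<^sub>R outer (sqrt \<bar>r\<bar> *\<^sub>R v)"
    by (simp add: outer_def vec_eq_iff del: quat_sel_times)
qed

lemma herm3_add: "herm3 a b c x y z + herm3 a' b' c' x' y' z' =
    herm3 (a + a') (b + b') (c + c') (x + x') (y + y') (z + z')"
  by (simp add: vec_eq_iff forall_3)

lemma herm3_diff: "herm3 a b c x y z - herm3 a' b' c' x' y' z' =
    herm3 (a - a') (b - b') (c - c') (x - x') (y - y') (z - z')"
  by (simp add: vec_eq_iff forall_3)

lemma herm3_scaleR: "r *\<^sub>R herm3 a b c x y z =
    herm3 (r * a) (r * b) (r * c) (r *\<^sub>R x) (r *\<^sub>R y) (r *\<^sub>R z)"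
  by (simp add: vec_eq_iff forall_3 of_real_def)

lemma herm3_inject:
  "herm3 a b c x y z = herm3 a' b' c' x' y' z' \<longleftrightarrow>
    a = a' \<and> b = b' \<and> c = c' \<and> x = x' \<and> y = y' \<and> z = z'"
proof
  assume "herm3 a b c x y z = herm3 a' b' c' x' y' z'"
  then have "herm3 a b c x y z $ i $ j = herm3 a' b' c' x' y' z' $ i $ j" for i j
    by simp
  from this[of 1 1] this[of 2 2] this[of 3 3] this[of 2 3] this[of 3 1] this[of 1 2]
  show "a = a' \<and> b = b' \<and> c = c' \<and> x = x' \<and> y = y' \<and> z = z'"
    by simp
qed simp

text \<open>
  The condition says that the second derivative of the determinant in direction \<open>X\<close>
  vanishes, so it is invariant under determinant-preserving linear maps.
\<close>

definition det_affine :: "quat^3^3 \<Rightarrow> bool" where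
  "det_affine X \<longleftrightarrow> (\<forall>Z\<in>J3H. detJ (Z + X) + detJ (Z - X) = 2 * detJ Z)"

text \<open>The trace form is nondegenerate: testing with the conjugate of \<open>v - w\<close>
  produces the norm of \<open>v - w\<close>.\<close>

lemma quat_eq_if_qre_mult:
  assumes "\<And>u. qre (u * v) = qre (u * w)"
  shows "v = w"
proof -
  have "qnorm2 (v - w) = qre (qcnj (v - w) * v) - qre (qcnj (v - w) * w)"
    by (simp add: qnorm2_def power2_eq_square algebra_simps)
  then show ?thesis
    using assms[of "qcnj (v - w)"] by (simp del: quat_sel_times)
qed

text \<open>The condition makes the quadratic adjoint of \<open>X\<close> vanish. Taking
  \<open>Z\<close> as the first idempotent, or with \<open>u\<close> as its only off-diagonal datum,
  isolates one diagonal and one off-diagonal entry of the adjoint; cyclic relabelling supplies the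
  others.\<close>

lemma det_affine_herm3_entry:
  assumes "det_affine (herm3 a b c x y z)"
  shows "b * c = qnorm2 x" "y * z = a *\<^sub>R qcnj x"
proof -
  have D: "detJ (herm3 (p + a) (q + b) (r + c) (u + x) (v + y) (w + z)) +
      detJ (herm3 (p - a) (q - b) (r - c) (u - x) (v - y) (w - z)) = 2 * detJ (herm3 p q r u v w)"
    for p q r u v w
    using assms herm3_in_J3H unfolding det_affine_def by (metis herm3_add herm3_diff)
  show "b * c = qnorm2 x"
    using D[of 1 0 0 0 0 0] unfolding detJ_herm3
    by (simp add: qnorm2_def power2_eq_square algebra_simps)
  show "y * z = a *\<^sub>R qcnj x"
  proof (rule quat_eq_if_qre_mult)
    show "qre (u * (y * z)) = qre (u * (a *\<^sub>R qcnj x))" for u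
      using D[of 0 0 0 u 0 0] unfolding detJ_herm3
      by (simp add: qnorm2_def power2_eq_square algebra_simps)
  qed
qed

lemma det_affine_herm3_cyclic:
  assumes "det_affine (herm3 a b c x y z)"
  shows "det_affine (herm3 b c a y z x)"
  unfolding det_affine_def
proof
  fix Z assume "Z \<in> J3H"
  then obtain p q r u v w where Z: "Z = herm3 p q r u v w"
    by (rule J3H_cases)
  show "detJ (Z + herm3 b c a y z x) + detJ (Z - herm3 b c a y z x) = 2 * detJ Z"
    using assms[unfolded det_affine_def, rule_format, of "herm3 r p q w u v"]
      detJ_herm3_cyclic[of r p q w u v]
      detJ_herm3_cyclic[of "r + a" "p + b" "q + c" "w + x" "u + y" "v + z"]
      detJ_herm3_cyclic[of "r - a" "p - b" "q - c" "w - x" "u - y" "v - z"]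
    by (simp only: Z herm3_in_J3H herm3_add herm3_diff)
qed

text \<open>A Hermitian matrix of rank one with nonzero corner \<open>a\<close> is determined by its
  first column, which is the vector used here.\<close>

lemma herm3_eq_scaleR_outer:
  assumes "a \<noteq> 0" "a * c = qnorm2 y" "a * b = qnorm2 z" "y * z = a *\<^sub>R qcnj x"
  shows "herm3 a b c x y z = (1 / a) *\<^sub>R outer (vector [of_real a, qcnj z, y])"
proof -
  have "qcnj z * qcnj y = a *\<^sub>R x"
    using arg_cong[OF assms(4), of qcnj] by simp
  then show ?thesis
    using assms(1,4) assms(2,3)[symmetric]
    by (simp add: vec_eq_iff forall_3 outer_def mult_qcnj of_real_def del: quat_sel_times)
qed

lemma herm3_eq_scaleR_outer_cyclic:
  assumes "herm3 b c a y z x = r *\<^sub>R outer w"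
  shows "herm3 a b c x y z = r *\<^sub>R outer (vector [w $ 3, w $ 1, w $ 2])"
  using assms by (simp add: vec_eq_iff forall_3 outer_def del: quat_sel_times)

lemma det_affine_imp_outer:
  assumes "X \<in> J3H" and "det_affine X"
  obtains s v where "s = 1 \<or> s = - 1" "X = s *\<^sub>R outer v"
proof -
  obtain a b c x y z where X: "X = herm3 a b c x y z"
    using assms(1) by (rule J3H_cases)
  have A1: "det_affine (herm3 a b c x y z)"
    using assms(2) X by simp
  note A2 = det_affine_herm3_cyclic[OF A1]
  note A3 = det_affine_herm3_cyclic[OF A2]
  note e = det_affine_herm3_entry[OF A1] det_affine_herm3_entry[OF A2] det_affine_herm3_entry[OF A3]
  have "\<exists>r v. X = r *\<^sub>R outer v"
  proof -
    consider "a \<noteq> 0" | "b \<noteq> 0" | "c \<noteq> 0" | "a = 0 \<and> b = 0 \<and> c = 0"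
      by blast
    then show ?thesis
    proof cases
      case 1
      then show ?thesis
        unfolding X using e herm3_eq_scaleR_outer[of a c y b z x] by (metis mult.commute)
    next
      case 2
      then have "herm3 b c a y z x = (1 / b) *\<^sub>R outer (vector [of_real b, qcnj x, z])"
        using e by (intro herm3_eq_scaleR_outer) (simp_all add: mult.commute del: quat_sel_times)
      then show ?thesis
        unfolding X by (blast dest: herm3_eq_scaleR_outer_cyclic)
    next
      case 3
      then have "herm3 c a b z x y = (1 / c) *\<^sub>R outer (vector [of_real c, qcnj y, x])"
        using e by (intro herm3_eq_scaleR_outer) (simp_all add: mult.commute del: quat_sel_times)
      then show ?thesis
        unfolding X by (blast dest: herm3_eq_scaleR_outer_cyclic)
    next
      \<comment> \<open>With zero diagonal, the equations of the form
        \<open>b * c = qnorm2 x\<close> annihilate all off-diagonal entries.\<close>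
      case 4
      then have "qnorm2 x = 0" "qnorm2 y = 0" "qnorm2 z = 0"
        using e by (simp_all del: quat_sel_times qnorm2_eq_0_iff)
      then have "X = 0 *\<^sub>R outer 0"
        using 4 by (simp add: X vec_eq_iff forall_3)
      then show ?thesis
        by blast
    qed
  qed
  then show ?thesis
    using scaleR_outer that by metis
qed

section \<open>Maps that fix the diagonal up to signs\<close>

lemma det_preserving_diagonal:
  assumes into: "\<And>X. X \<in> J3H \<Longrightarrow> f X \<in> J3H"
    and add: "\<And>X Y. X \<in> J3H \<Longrightarrow> Y \<in> J3H \<Longrightarrow> f (X + Y) = f X + f Y"
    and scale: "\<And>c X. X \<in> J3H \<Longrightarrow> f (c *\<^sub>R X) = c *\<^sub>R f X"
    and det: "\<And>X. X \<in> J3H \<Longrightarrow> detJ (f X) = detJ X"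
    and diag: "\<And>a b c. f (herm3 a b c 0 0 0) = herm3 (s1 * a) (s2 * b) (s3 * c) 0 0 0"
    and s: "s1 = 1 \<or> s1 = - 1" "s2 = 1 \<or> s2 = - 1" "s3 = 1 \<or> s3 = - 1"
  obtains d where "\<And>X. X \<in> J3H \<Longrightarrow> f X = herm_act (qdiag d) X"
proof -
  have off: "\<exists>x' y' z'. f (herm3 0 0 0 x y z) = herm3 0 0 0 x' y' z' \<and>
      s1 * qnorm2 x' = qnorm2 x \<and> s2 * qnorm2 y' = qnorm2 y \<and> s3 * qnorm2 z' = qnorm2 z \<and>
      qre (x' * y' * z') = qre (x * y * z)" for x y z
  proof -
    obtain A B C x' y' z' where F: "f (herm3 0 0 0 x y z) = herm3 A B C x' y' z'"
      using into[of "herm3 0 0 0 x y z"] by (auto elim: J3H_cases)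
    \<comment> \<open>A variable diagonal \<open>p\<close>, \<open>q\<close>, \<open>r\<close> is
      added, so that preservation of \<open>detJ\<close> becomes an identity of polynomials in three
      real variables whose coefficients can be compared.\<close>
    have D: "(s1 * p + A) * (s2 * q + B) * (s3 * r + C) + 2 * qre (x' * y' * z')
        - ((s1 * p + A) * qnorm2 x' + (s2 * q + B) * qnorm2 y' + (s3 * r + C) * qnorm2 z')
      = p * q * r + 2 * qre (x * y * z) - (p * qnorm2 x + q * qnorm2 y + r * qnorm2 z)" for p q r
    proof -
      have "f (herm3 p q r x y z) = f (herm3 p q r 0 0 0) + f (herm3 0 0 0 x y z)"
        using add[of "herm3 p q r 0 0 0" "herm3 0 0 0 x y z"] by (simp add: herm3_add)
      then have "f (herm3 p q r x y z) = herm3 (s1 * p + A) (s2 * q + B) (s3 * r + C) x' y' z'"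
        by (simp add: diag F herm3_add)
      then show ?thesis
        using det[of "herm3 p q r x y z"] by (simp only: detJ_herm3 herm3_in_J3H)
    qed
    define L where "L p q r = (s1 * p + A) * (s2 * q + B) * (s3 * r + C) + 2 * qre (x' * y' * z')
        - ((s1 * p + A) * qnorm2 x' + (s2 * q + B) * qnorm2 y' + (s3 * r + C) * qnorm2 z')" for p q r
    have L: "L p q r = p * q * r + 2 * qre (x * y * z) - (p * qnorm2 x + q * qnorm2 y + r * qnorm2 z)" for p q r
      unfolding L_def by (rule D)
    \<comment> \<open>Mixed second differences extract the coefficients of \<open>p * q\<close>,
      \<open>p * r\<close> and \<open>q * r\<close>, which are absent from the right-hand side of
      \<open>L\<close>.\<close>
    have "s1 * s2 * C = L 1 1 0 - L 1 0 0 - L 0 1 0 + L 0 0 0"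
      "s1 * s3 * B = L 1 0 1 - L 1 0 0 - L 0 0 1 + L 0 0 0"
      "s2 * s3 * A = L 0 1 1 - L 0 1 0 - L 0 0 1 + L 0 0 0"
      by (simp_all add: L_def algebra_simps del: quat_sel_times)
    then have "s1 * s2 * C = 0" "s1 * s3 * B = 0" "s2 * s3 * A = 0"
      unfolding L by (simp_all del: quat_sel_times)
    moreover have "s1 \<noteq> 0" "s2 \<noteq> 0" "s3 \<noteq> 0"
      using s by auto
    ultimately have ABC: "A = 0" "B = 0" "C = 0"
      by simp_all
    note D' = D[unfolded ABC]
    have re: "qre (x' * y' * z') = qre (x * y * z)"
      using D'[of 0 0 0] by (simp del: quat_sel_times)
    have "s1 * qnorm2 x' = qnorm2 x" "s2 * qnorm2 y' = qnorm2 y" "s3 * qnorm2 z' = qnorm2 z"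
      using D'[of 1 0 0] D'[of 0 1 0] D'[of 0 0 1] unfolding re by (simp_all del: quat_sel_times)
    with re show ?thesis
      unfolding F ABC by blast
  qed
  have "s1 = 1" "s2 = 1" "s3 = 1"
  proof -
    \<comment> \<open>At \<open>x = y = z = 1\<close> each sign times a nonnegative norm equals
      1.\<close>
    have "s \<noteq> - 1" if "s * qnorm2 x = qnorm2 1" for s x
      using that qnorm2_nonneg[of x] by auto
    then show "s1 = 1" "s2 = 1" "s3 = 1"
      using off[of 1 1 1] s by metis+
  qed
  note off = off[unfolded this mult_1_left]
  define b1 where "b1 x = f (herm3 0 0 0 x 0 0) $ 2 $ 3" for x
  define b2 where "b2 x = f (herm3 0 0 0 0 x 0) $ 3 $ 1" for x
  define b3 where "b3 x = f (herm3 0 0 0 0 0 x) $ 1 $ 2" for x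
  \<comment> \<open>Norms are preserved slot by slot, so a zero slot stays zero and each
    off-diagonal slot is mapped to itself.\<close>
  have f1: "f (herm3 0 0 0 x 0 0) = herm3 0 0 0 (b1 x) 0 0" "qnorm2 (b1 x) = qnorm2 x" for x
    using off[of x 0 0] by (auto simp: b1_def)
  have f2: "f (herm3 0 0 0 0 x 0) = herm3 0 0 0 0 (b2 x) 0" "qnorm2 (b2 x) = qnorm2 x" for x
    using off[of 0 x 0] by (auto simp: b2_def)
  have f3: "f (herm3 0 0 0 0 0 x) = herm3 0 0 0 0 0 (b3 x)" "qnorm2 (b3 x) = qnorm2 x" for x
    using off[of 0 0 x] by (auto simp: b3_def)
  have f0: "f (herm3 0 0 0 x y z) = herm3 0 0 0 (b1 x) (b2 y) (b3 z)" for x y z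
    using add[of "herm3 0 0 0 x y 0" "herm3 0 0 0 0 0 z"] add[of "herm3 0 0 0 x 0 0" "herm3 0 0 0 0 y 0"]
    by (simp add: herm3_add f1 f2 f3)
  have f: "f (herm3 a b c x y z) = herm3 a b c (b1 x) (b2 y) (b3 z)" for a b c x y z
    using add[of "herm3 a b c 0 0 0" "herm3 0 0 0 x y z"]
    by (simp add: herm3_add diag f0 \<open>s1 = 1\<close> \<open>s2 = 1\<close> \<open>s3 = 1\<close>)
  have "linear b3"
  proof (rule linearI)
    show "b3 (x + y) = b3 x + b3 y" for x y
      using add[of "herm3 0 0 0 0 0 x" "herm3 0 0 0 0 0 y"] by (simp add: b3_def herm3_add)
    show "b3 (r *\<^sub>R x) = r *\<^sub>R b3 x" for r x
      using scale[of "herm3 0 0 0 0 0 x" r] by (simp add: b3_def herm3_scaleR)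
  qed
  moreover have "qre (b1 x * b2 y * b3 z) = qre (x * y * z)" for x y z
    using off[of x y z] unfolding f0 herm3_inject by metis
  ultimately obtain d1 d2 d3 where d: "qnorm2 d1 = 1" "qnorm2 d2 = 1" "qnorm2 d3 = 1"
    and b: "\<And>x. b1 x = d2 * x * qcnj d3" "\<And>x. b2 x = d3 * x * qcnj d1" "\<And>x. b3 x = d1 * x * qcnj d2"
    using quat_triality[of b3 b1 b2] f1(2) f2(2) f3(2) by metis
  have "f X = herm_act (qdiag (vector [d1, d2, d3])) X" if "X \<in> J3H" for X
    using that by (elim J3H_cases) (simp add: f herm_act_qdiag b d del: quat_sel_times)
  then show ?thesis
    by (rule that)
qed

section \<open>Determinant-preserving maps come from matrices\<close>

lemma herm_act_diagonal:
  "herm_act V (herm3 a b c 0 0 0) =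
    a *\<^sub>R outer (column 1 V) + b *\<^sub>R outer (column 2 V) + c *\<^sub>R outer (column 3 V)"
  by (simp add: vec_eq_iff herm_act_def matrix_matrix_mult_def sum_3 outer_def column_def hadj_nth
      of_real_def del: quat_sel_times)

text \<open>The inverse is formed in the group \<open>SUstar6\<close>, lies in the range of
  \<open>cmat\<close> by the relation with \<open>Jmat\<close>, and is pulled back by
  injectivity.\<close>

lemma det_cmat_eq_1_invertible:
  assumes "det (cmat A) = 1"
  obtains B where "A ** B = mat 1" "B ** A = mat 1" "det (cmat B) = 1"
proof -
  interpret G: group SUstar6 by (rule group_SUstar6)
  have A: "cmat A \<in> carrier SUstar6"
    using assms by (simp add: SUstar6_def Jmat_cmat)
  define C where "C = inv\<^bsub>SUstar6\<^esub> cmat A"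
  have C: "C \<in> carrier SUstar6" "C ** cmat A = mat 1" "cmat A ** C = mat 1"
    using A G.inv_closed G.l_inv G.r_inv unfolding C_def by (simp_all add: SUstar6_def)
  then obtain B where B: "C = cmat B"
    using range_cmat by (auto simp: SUstar6_def)
  show ?thesis
  proof (rule that)
    show "A ** B = mat 1" "B ** A = mat 1"
      using C(2,3) unfolding B by (metis cmat_mult cmat_mat_1 inj_cmat injD)+
    show "det (cmat B) = 1"
      using C(1) unfolding B by (simp add: SUstar6_def)
  qed
qed

lemma detJ_mat_1: "mat 1 \<in> J3H" "detJ (mat 1) = 1"
proof -
  have "mat 1 = herm3 1 1 1 0 0 0"
    by (simp add: vec_eq_iff forall_3 mat_def)
  then show "mat 1 \<in> J3H" "detJ (mat 1) = 1"
    by (simp_all add: detJ_herm3)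
qed

text \<open>The same constant \<open>c\<close> governs both sides; the identity matrix, where
  \<open>detJ\<close> is 1, detects whether it equals 1.\<close>

lemma det_cmat_eq_1_iff:
  "det (cmat A) = 1 \<longleftrightarrow> (\<forall>X\<in>J3H. detJ (herm_act A X) = detJ X)"
proof -
  obtain c where "det (cmat A) = of_real c" "\<And>X. X \<in> J3H \<Longrightarrow> detJ (herm_act A X) = c * detJ X"
    using detJ_herm_act_cmat by blast
  then show ?thesis
    using detJ_mat_1 by (metis mult_1_left mult_1_right of_real_1 of_real_eq_1_iff)
qed

text \<open>
  The images of the diagonal idempotents are, up to sign, \<open>v v\<^sup>*\<close> for vectors \<open>v\<close>, which form
  the columns of a matrix \<open>V\<close>. Undoing the action of \<open>V\<close> reduces to a map fixing the diagonal.
\<close>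

lemma det_preserving_imp_herm_act:
  assumes bij: "bij_betw f J3H J3H"
    and add: "\<And>X Y. X \<in> J3H \<Longrightarrow> Y \<in> J3H \<Longrightarrow> f (X + Y) = f X + f Y"
    and scale: "\<And>c X. X \<in> J3H \<Longrightarrow> f (c *\<^sub>R X) = c *\<^sub>R f X"
    and det: "\<And>X. X \<in> J3H \<Longrightarrow> detJ (f X) = detJ X"
  obtains A where "det (cmat A) = 1" "\<And>X. X \<in> J3H \<Longrightarrow> f X = herm_act A X"
proof -
  have into: "f X \<in> J3H" if "X \<in> J3H" for X
    using bij that by (auto simp: bij_betw_def)
  have diff: "f (X - Y) = f X - f Y" if "X \<in> J3H" "Y \<in> J3H" for X Y
    using add[of X "(- 1) *\<^sub>R Y"] scale[of Y "- 1"] J3H_scaleR[of Y "- 1"] that by simp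
  have affine: "det_affine (f X)" if X: "X \<in> J3H" "det_affine X" for X
    unfolding det_affine_def
  proof
    \<comment> \<open>Surjectivity of \<open>f\<close> is what allows an arbitrary test element
      \<open>Z\<close> to be pulled back to \<open>W\<close>.\<close>
    fix Z assume "Z \<in> J3H"
    then obtain W where W: "W \<in> J3H" "Z = f W"
      using bij by (auto simp: bij_betw_def)
    have "W - X \<in> J3H"
      using J3H_add[of W "(- 1) *\<^sub>R X"] J3H_scaleR[of X "- 1"] W X by simp
    then show "detJ (Z + f X) + detJ (Z - f X) = 2 * detJ Z"
      using X W det[of "W + X"] det[of "W - X"] det[of W] J3H_add[of W X]
      by (simp add: det_affine_def add diff)
  qed
  have E: "det_affine (herm3 1 0 0 0 0 0)" "det_affine (herm3 0 1 0 0 0 0)" "det_affine (herm3 0 0 1 0 0 0)"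
    unfolding det_affine_def
    by (auto elim!: J3H_cases simp: herm3_add herm3_diff detJ_herm3 algebra_simps simp del: quat_sel_times)
  obtain s1 v1 where v1: "s1 = 1 \<or> s1 = - 1" "f (herm3 1 0 0 0 0 0) = s1 *\<^sub>R outer v1"
    using det_affine_imp_outer into affine E(1) herm3_in_J3H by metis
  obtain s2 v2 where v2: "s2 = 1 \<or> s2 = - 1" "f (herm3 0 1 0 0 0 0) = s2 *\<^sub>R outer v2"
    using det_affine_imp_outer into affine E(2) herm3_in_J3H by metis
  obtain s3 v3 where v3: "s3 = 1 \<or> s3 = - 1" "f (herm3 0 0 1 0 0 0) = s3 *\<^sub>R outer v3"
    using det_affine_imp_outer into affine E(3) herm3_in_J3H by metis
  define V where "V = transpose (vector [v1, v2, v3] :: quat^3^3)"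
  have V: "column 1 V = v1" "column 2 V = v2" "column 3 V = v3"
    by (simp_all add: V_def column_def transpose_def vec_eq_iff)
  have fd: "f (herm3 a b c 0 0 0) = herm_act V (herm3 (s1 * a) (s2 * b) (s3 * c) 0 0 0)" for a b c
  proof -
    have "herm3 a b c 0 0 0 = a *\<^sub>R herm3 1 0 0 0 0 0 + (b *\<^sub>R herm3 0 1 0 0 0 0 + c *\<^sub>R herm3 0 0 1 0 0 0)"
      by (simp add: herm3_scaleR herm3_add)
    then have "f (herm3 a b c 0 0 0) = a *\<^sub>R s1 *\<^sub>R outer v1 + (b *\<^sub>R s2 *\<^sub>R outer v2 + c *\<^sub>R s3 *\<^sub>R outer v3)"
      by (simp add: add scale v1(2) v2(2) v3(2) J3H_add J3H_scaleR)
    then show ?thesis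
      by (simp add: herm_act_diagonal V mult.commute)
  qed
  obtain c where c: "c \<ge> 0" "det (cmat V) = of_real c"
    "\<And>X. X \<in> J3H \<Longrightarrow> detJ (herm_act V X) = c * detJ X"
    using detJ_herm_act_cmat by blast
  \<comment> \<open>This evaluates \<open>detJ\<close> at the image of the identity. The product of
    the signs is 1 or -1, so \<open>c >= 0\<close> forces \<open>c = 1\<close> while the signs are
    still unknown.\<close>
  have "c * (s1 * s2 * s3) = 1"
    using det[of "herm3 1 1 1 0 0 0"] c(3) by (simp add: fd detJ_herm3)
  then have "c = 1"
    using c(1) v1(1) v2(1) v3(1) by auto
  then have "det (cmat V) = 1"
    using c by simp
  then obtain W where W: "V ** W = mat 1" "W ** V = mat 1" "det (cmat W) = 1"
    by (rule det_cmat_eq_1_invertible)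
  obtain d where d: "\<And>X. X \<in> J3H \<Longrightarrow> herm_act W (f X) = herm_act (qdiag d) X"
  proof (rule det_preserving_diagonal[of "\<lambda>X. herm_act W (f X)" s1 s2 s3])
    show "herm_act W (f X) \<in> J3H" if "X \<in> J3H" for X
      using that into herm_act_J3H by blast
    show "herm_act W (f (X + Y)) = herm_act W (f X) + herm_act W (f Y)" if "X \<in> J3H" "Y \<in> J3H" for X Y
      using that by (simp add: add herm_act_add)
    show "herm_act W (f (r *\<^sub>R X)) = r *\<^sub>R herm_act W (f X)" if "X \<in> J3H" for r X
      using that by (simp add: scale herm_act_scaleR)
    show "detJ (herm_act W (f X)) = detJ X" if "X \<in> J3H" for X
      using that W(3) into det det_cmat_eq_1_iff by simp
    show "herm_act W (f (herm3 a b c 0 0 0)) = herm3 (s1 * a) (s2 * b) (s3 * c) 0 0 0" for a b c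
      by (simp add: fd W flip: herm_act_mult)
  qed (use v1 v2 v3 in auto)
  have f: "f X = herm_act (V ** qdiag d) X" if "X \<in> J3H" for X
    using d[OF that] by (metis W(1) herm_act_mult herm_act_mat_1)
  show ?thesis
  proof (rule that[of "V ** qdiag d"])
    show "det (cmat (V ** qdiag d)) = 1"
      unfolding det_cmat_eq_1_iff using f det by simp
  qed (rule f)
qed

text \<open>The three diagonal idempotents force \<open>A\<close> to be diagonal with unit entries.
  The off-diagonal elements then force these entries to coincide and to commute with every
  quaternion.\<close>

lemma herm_act_trivial_imp:
  assumes "\<And>X. X \<in> J3H \<Longrightarrow> herm_act A X = X"
  shows "A = mat 1 \<or> A = - mat 1"
proof -
  have "herm_act A (herm3 1 0 0 0 0 0) $ r $ s = herm3 1 0 0 0 0 0 $ r $ s"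
    "herm_act A (herm3 0 1 0 0 0 0) $ r $ s = herm3 0 1 0 0 0 0 $ r $ s"
    "herm_act A (herm3 0 0 1 0 0 0) $ r $ s = herm3 0 0 1 0 0 0 $ r $ s" for r s
    by (simp_all add: assms)
  then have e: "A $ r $ 1 * qcnj (A $ s $ 1) = herm3 1 0 0 0 0 0 $ r $ s"
    "A $ r $ 2 * qcnj (A $ s $ 2) = herm3 0 1 0 0 0 0 $ r $ s"
    "A $ r $ 3 * qcnj (A $ s $ 3) = herm3 0 0 1 0 0 0 $ r $ s" for r s
    by (simp_all add: herm_act_diagonal outer_def column_def del: quat_sel_times)
  have z: "A $ 2 $ 1 = 0" "A $ 3 $ 1 = 0" "A $ 1 $ 2 = 0" "A $ 3 $ 2 = 0" "A $ 1 $ 3 = 0" "A $ 2 $ 3 = 0"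
    using e(1)[of 2 2] e(1)[of 3 3] e(2)[of 1 1] e(2)[of 3 3] e(3)[of 1 1] e(3)[of 2 2]
    by (simp_all del: quat_sel_times)
  have "qnorm2 (A $ i $ i) = 1" for i
  proof -
    have "A $ i $ i * qcnj (A $ i $ i) = 1"
      using e(1)[of 1 1] e(2)[of 2 2] e(3)[of 3 3] exhaust_3[of i] by (auto simp del: quat_sel_times)
    then show ?thesis
      by (metis mult_qcnj(1) of_real_eq_1_iff)
  qed
  then have n: "A $ i $ i * qcnj (A $ i $ i) = 1" "qcnj (A $ i $ i) * A $ i $ i = 1"
    "qnorm2 (A $ i $ i) = 1" for i
    by (simp_all add: mult_qcnj)
  have A: "A = qdiag (\<chi> i. A $ i $ i)"
    by (simp add: vec_eq_iff forall_3 qdiag_def z)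
  have c: "A $ 2 $ 2 * x * qcnj (A $ 3 $ 3) = x" "A $ 3 $ 3 * x * qcnj (A $ 1 $ 1) = x" for x
    using assms[of "herm3 0 0 0 x x 0"] herm_act_qdiag[of "\<chi> i. A $ i $ i" 0 0 0 x x 0]
    by (simp_all add: herm3_inject flip: A del: quat_sel_times)
  have c': "A $ 2 $ 2 * x = x * A $ 3 $ 3" "A $ 3 $ 3 * x = x * A $ 1 $ 1" for x
    using c[of x] n(2) by (metis mult.assoc mult.right_neutral)+
  then have eq: "A $ 2 $ 2 = A $ 3 $ 3" "A $ 3 $ 3 = A $ 1 $ 1"
    using c'[of 1] by (simp_all del: quat_sel_times)
  then have "A $ 1 $ 1 = 1 \<or> A $ 1 $ 1 = - 1"
    using c' n by (intro quat_central_unit) metis+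
  then show ?thesis
    by (auto simp: vec_eq_iff forall_3 mat_def z eq)
qed

section \<open>The isomorphism\<close>

lemma uminus_quat_matrix_mult:
  fixes A B :: "quat^3^3"
  shows "(- A) ** B = - (A ** B)" "A ** (- B) = - (A ** B)"
  by (simp_all add: vec_eq_iff matrix_matrix_mult_def sum_negf)

lemma herm_act_uminus: "herm_act (- A) X = herm_act A X"
proof -
  have "hadj (- A) = - hadj A"
    by (simp add: vec_eq_iff hadj_nth)
  then show ?thesis
    by (simp add: herm_act_def uminus_quat_matrix_mult)
qed

lemma carrier_SUstar6: "carrier SUstar6 = cmat ` {A. det (cmat A) = 1}"
  using range_cmat Jmat_cmat by (auto simp: SUstar6_def image_iff)

lemma carrier_E6H_iff:
  "f \<in> carrier E6H \<longleftrightarrow> f \<in> Bij J3H \<and>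
    (\<forall>X\<in>J3H. \<forall>Y\<in>J3H. f (X + Y) = f X + f Y) \<and> (\<forall>c::real. \<forall>X\<in>J3H. f (c *\<^sub>R X) = c *\<^sub>R f X) \<and>
    (\<forall>X\<in>J3H. detJ (f X) = detJ X)"
  by (auto simp: E6H_def Iso_J3H_def)

lemma mult_E6H:
  "f \<in> Bij J3H \<Longrightarrow> g \<in> Bij J3H \<Longrightarrow> f \<otimes>\<^bsub>E6H\<^esub> g = compose J3H f g"
  by (simp add: E6H_def BijGroup_def)

lemma one_E6H: "\<one>\<^bsub>E6H\<^esub> = (\<lambda>X\<in>J3H. X)"
  by (simp add: E6H_def BijGroup_def)

text \<open>The action is transported to complex matrices through the inverse of the injective map
  \<open>cmat\<close>, and restricted because the elements of \<open>E6H\<close> are extensional on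
  \<open>J3H\<close>.\<close>

definition herm_action :: "complex^6^6 \<Rightarrow> quat^3^3 \<Rightarrow> quat^3^3" where
  "herm_action B = restrict (herm_act (inv_into UNIV cmat B)) J3H"

lemma herm_action_cmat: "herm_action (cmat A) = restrict (herm_act A) J3H"
  by (simp add: herm_action_def inj_cmat)

lemma herm_action_in_E6H:
  assumes "det (cmat A) = 1"
  shows "restrict (herm_act A) J3H \<in> carrier E6H"
proof -
  obtain B where B: "A ** B = mat 1" "B ** A = mat 1"
    using assms by (rule det_cmat_eq_1_invertible)
  have "bij_betw (restrict (herm_act A) J3H) J3H J3H"
    by (rule bij_betw_byWitness[where f' = "herm_act B"])
      (auto simp: herm_act_J3H B simp flip: herm_act_mult)
  then show ?thesis
    using assms
    by (simp add: carrier_E6H_iff Bij_def det_cmat_eq_1_iff J3H_add J3H_scaleR herm_act_add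
        herm_act_scaleR)
qed

lemma herm_action_hom: "herm_action \<in> hom SUstar6 E6H"
proof (rule homI)
  show "herm_action B \<in> carrier E6H" if "B \<in> carrier SUstar6" for B
    using that herm_action_in_E6H by (auto simp: carrier_SUstar6 herm_action_cmat)
  show "herm_action (B \<otimes>\<^bsub>SUstar6\<^esub> C) = herm_action B \<otimes>\<^bsub>E6H\<^esub> herm_action C"
    if BC: "B \<in> carrier SUstar6" "C \<in> carrier SUstar6" for B C
  proof -
    obtain A D where A: "B = cmat A" "det (cmat A) = 1" and D: "C = cmat D" "det (cmat D) = 1"
      using BC by (auto simp: carrier_SUstar6)
    have "B \<otimes>\<^bsub>SUstar6\<^esub> C = cmat (A ** D)"
      by (simp add: A D SUstar6_def cmat_mult)
    moreover have "restrict (herm_act A) J3H \<otimes>\<^bsub>E6H\<^esub> restrict (herm_act D) J3H =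
        compose J3H (restrict (herm_act A) J3H) (restrict (herm_act D) J3H)"
      using herm_action_in_E6H A D by (intro mult_E6H) (simp_all add: carrier_E6H_iff)
    ultimately show ?thesis
      by (auto simp: A D herm_action_cmat compose_def herm_act_mult herm_act_J3H restrict_def)
  qed
qed

lemma herm_action_surj: "herm_action ` carrier SUstar6 = carrier E6H"
proof
  show "herm_action ` carrier SUstar6 \<subseteq> carrier E6H"
    using herm_action_hom by (auto simp: hom_def)
  show "carrier E6H \<subseteq> herm_action ` carrier SUstar6"
  proof
    fix f assume f: "f \<in> carrier E6H"
    then have "bij_betw f J3H J3H" "f \<in> extensional J3H"
      by (auto simp: carrier_E6H_iff Bij_def)
    then obtain A where A: "det (cmat A) = 1" "\<And>X. X \<in> J3H \<Longrightarrow> f X = herm_act A X"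
      using f det_preserving_imp_herm_act[of f] unfolding carrier_E6H_iff by metis
    have "f = herm_action (cmat A)"
      unfolding herm_action_cmat
      using A(2) \<open>f \<in> extensional J3H\<close> by (auto intro: extensionalityI)
    then show "f \<in> herm_action ` carrier SUstar6"
      using A(1) by (auto simp: carrier_SUstar6)
  qed
qed

lemma herm_action_kernel: "kernel SUstar6 E6H herm_action = {mat 1, - mat 1}"
proof
  show "kernel SUstar6 E6H herm_action \<subseteq> {mat 1, - mat 1}"
  proof
    fix B assume "B \<in> kernel SUstar6 E6H herm_action"
    then obtain A where A: "B = cmat A" "restrict (herm_act A) J3H = (\<lambda>X\<in>J3H. X)"
      by (auto simp: kernel_def carrier_SUstar6 herm_action_cmat one_E6H)
    have "herm_act A X = X" if "X \<in> J3H" for X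
      using fun_cong[OF A(2), of X] that by simp
    then have "A = mat 1 \<or> A = - mat 1"
      by (rule herm_act_trivial_imp)
    then show "B \<in> {mat 1, - mat 1}"
      using A(1) by (auto simp: cmat_uminus cmat_mat_1)
  qed
  have "herm_action (mat 1) = \<one>\<^bsub>E6H\<^esub>" "herm_action (- mat 1) = \<one>\<^bsub>E6H\<^esub>"
    using herm_action_cmat[of "mat 1"] herm_action_cmat[of "- mat 1"]
    by (auto simp: cmat_mat_1 cmat_uminus one_E6H herm_act_uminus restrict_def)
  moreover have "mat 1 \<in> carrier SUstar6"
    using group.is_monoid[OF group_SUstar6, THEN monoid.one_closed] by (simp add: SUstar6_def)
  ultimately show "{mat 1, - mat 1} \<subseteq> kernel SUstar6 E6H herm_action"
    using uminus_one_SUstar6 by (simp add: kernel_def)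
qed

theorem theorem5p5p5:
  shows "E6H \<cong> SUstar6 Mod {mat 1, - mat 1}"
proof -
  interpret group_hom SUstar6 E6H herm_action
    by (simp add: group_hom_def group_hom_axioms_def group_SUstar6 group_E6H herm_action_hom)
  have "SUstar6 Mod {mat 1, - mat 1} \<cong> E6H"
    using FactGroup_iso[OF herm_action_surj] by (simp add: herm_action_kernel)
  moreover have "group (SUstar6 Mod {mat 1, - mat 1})"
    using normal_pm_one by (rule normal.factorgroup_is_group)
  ultimately show ?thesis
    by (simp add: group.iso_sym)
qed

end
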